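(* Let $G$ be a projectively universal countable metrizable group. Then the Rajkov completion $\hat{G}$ of $G$ is a projectively universal Polish group.
   Context: All topological groups are assumed Hausdorff. A topological group is Polish if it is homeomorphic to a complete separable metric space. For a topological group $G$, the Rajkov completion $\hat G$ is the completion of $G$ with respect to the upper bound (join) of the left and right uniformities of $G$; it is a topological group containing $G$ as a dense topological subgroup. A countable metrizable topological group $G$ is called a projectively universal countable metrizable group if every countable metrizable topological group $H$ is isomorphic, as a topological group, to a quotient $G/N$ (with the quotient topology) for some closed normal subgroup $N$ of $G$. A Polish group $P$ is called a projectively universal (or couniversal) Polish group if every Polish group $H$ is isomorphic, as a topological group, to a quotient $P/N$ (with the quotient topology) for some closed normal subgroup $N$ of $P$. *)

theory Defs
  imports "HOL-Analysis.Analysis" "HOL-Algebra.Coset"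
begin

section \<open>Topological groups\<close>

locale topological_group = group G for G (structure) +
  fixes T :: "'a topology"
  assumes topspace_eq_carrier: "topspace T = carrier G"
    and continuous_mult: "continuous_map (prod_topology T T) T (\<lambda>(x, y). x \<otimes> y)"
    and continuous_inv: "continuous_map T T (\<lambda>x. inv x)"
    and Hausdorff: "Hausdorff_space T"

definition topological_group_isomorphic ::
    "'a monoid \<Rightarrow> 'a topology \<Rightarrow> 'b monoid \<Rightarrow> 'b topology \<Rightarrow> bool" where
  "topological_group_isomorphic G T H S \<longleftrightarrow> (\<exists>h. h \<in> iso G H \<and> homeomorphic_map T S h)"

text \<open>The points of \<open>G Mod N\<close> are cosets, so the preimage of a set \<open>W\<close> of cosets under the
  projection \<open>G \<rightarrow> G Mod N\<close> is the union of \<open>W\<close>.\<close>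

definition quotient_group_topology :: "'a monoid \<Rightarrow> 'a topology \<Rightarrow> 'a set \<Rightarrow> 'a set topology" where
  "quotient_group_topology G T N =
     topology (\<lambda>W. W \<subseteq> carrier (G Mod N) \<and> openin T (\<Union>W))"

lemma (in group) Union_Int_cosets:
  assumes "subgroup N G" "A \<subseteq> carrier (G Mod N)" "B \<subseteq> carrier (G Mod N)"
  shows "\<Union>(A \<inter> B) = \<Union>A \<inter> \<Union>B"
proof -
  have "C = D" if "C \<in> A" "D \<in> B" "x \<in> C" "x \<in> D" for C D x
  proof -
    have "C \<in> rcosets N" "D \<in> rcosets N"
      using assms(2,3) that by (auto simp: FactGroup_def)
    then show ?thesis
      using rcos_disjoint[OF assms(1)] that unfolding pairwise_def disjnt_iff by blast
  qed
  then show ?thesis by blast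
qed

lemma openin_quotient_group_topology:
  assumes "topological_group G T" "subgroup N G"
  shows "openin (quotient_group_topology G T N) W \<longleftrightarrow>
           W \<subseteq> carrier (G Mod N) \<and> openin T (\<Union>W)"
proof -
  interpret topological_group G T by fact
  have "openin T (\<Union>(\<Union>\<K>))" if "\<forall>K\<in>\<K>. openin T (\<Union>K)" for \<K> :: "'a set set set"
  proof -
    have "\<Union>(\<Union>\<K>) = (\<Union>K\<in>\<K>. \<Union>K)" by blast
    with that show ?thesis by (metis (no_types, lifting) imageE openin_Union)
  qed
  then have "istopology (\<lambda>W. W \<subseteq> carrier (G Mod N) \<and> openin T (\<Union>W))"
    unfolding istopology_def by (auto simp: Union_Int_cosets[OF assms(2)] intro: openin_Int)
  then show ?thesis
    by (simp add: quotient_group_topology_def topology_inverse')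
qed


section \<open>Uniform spaces with an explicit carrier\<close>

text \<open>As in the type class \<^class>\<open>uniform_space\<close>, a uniformity is a filter of entourages on pairs;
  here it lives on a set \<open>X\<close>.\<close>

definition uniform_space_on :: "'a set \<Rightarrow> ('a \<times> 'a) filter \<Rightarrow> bool" where
  "uniform_space_on X U \<longleftrightarrow>
     U \<le> principal (X \<times> X) \<and>
     (\<forall>E. eventually E U \<longrightarrow> (\<forall>x\<in>X. E (x, x))) \<and>
     (\<forall>E. eventually E U \<longrightarrow> eventually (\<lambda>(x, y). E (y, x)) U) \<and>
     (\<forall>E. eventually E U \<longrightarrow>
        (\<exists>D. eventually D U \<and> (\<forall>x y z. D (x, y) \<longrightarrow> D (y, z) \<longrightarrow> E (x, z))))"

definition uniform_topology :: "'a set \<Rightarrow> ('a \<times> 'a) filter \<Rightarrow> 'a topology" where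
  "uniform_topology X U =
     topology (\<lambda>W. W \<subseteq> X \<and> (\<forall>x\<in>W. eventually (\<lambda>(x', y). x' = x \<longrightarrow> y \<in> W) U))"

lemma openin_uniform_topology:
  "openin (uniform_topology X U) W \<longleftrightarrow>
     W \<subseteq> X \<and> (\<forall>x\<in>W. eventually (\<lambda>(x', y). x' = x \<longrightarrow> y \<in> W) U)"
proof -
  have "istopology (\<lambda>W. W \<subseteq> X \<and> (\<forall>x\<in>W. eventually (\<lambda>(x', y). x' = x \<longrightarrow> y \<in> W) U))"
    unfolding istopology_def
  proof (intro conjI allI impI ballI)
    fix A B x
    assume "A \<subseteq> X \<and> (\<forall>x\<in>A. \<forall>\<^sub>F (x', y) in U. x' = x \<longrightarrow> y \<in> A)"
      and "B \<subseteq> X \<and> (\<forall>x\<in>B. \<forall>\<^sub>F (x', y) in U. x' = x \<longrightarrow> y \<in> B)" and "x \<in> A \<inter> B"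
    then have "\<forall>\<^sub>F (x', y) in U. x' = x \<longrightarrow> y \<in> A" "\<forall>\<^sub>F (x', y) in U. x' = x \<longrightarrow> y \<in> B"
      by auto
    then show "\<forall>\<^sub>F (x', y) in U. x' = x \<longrightarrow> y \<in> A \<inter> B"
      by eventually_elim auto
  next
    fix \<K> x
    assume \<K>: "\<forall>K\<in>\<K>. K \<subseteq> X \<and> (\<forall>x\<in>K. \<forall>\<^sub>F (x', y) in U. x' = x \<longrightarrow> y \<in> K)" and "x \<in> \<Union>\<K>"
    then obtain K where "K \<in> \<K>" "\<forall>\<^sub>F (x', y) in U. x' = x \<longrightarrow> y \<in> K"
      by blast
    from this(2) show "\<forall>\<^sub>F (x', y) in U. x' = x \<longrightarrow> y \<in> \<Union>\<K>"
      by eventually_elim (use \<open>K \<in> \<K>\<close> in auto)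
  qed blast+
  then show ?thesis
    by (simp add: uniform_topology_def topology_inverse')
qed

definition complete_uniform_space_on :: "'a set \<Rightarrow> ('a \<times> 'a) filter \<Rightarrow> bool" where
  "complete_uniform_space_on X U \<longleftrightarrow>
     uniform_space_on X U \<and>
     (\<forall>F. F \<noteq> bot \<longrightarrow> F \<le> principal X \<longrightarrow> F \<times>\<^sub>F F \<le> U \<longrightarrow>
        (\<exists>x\<in>X. F \<le> nhdsin (uniform_topology X U) x))"

text \<open>\<open>(Y, V)\<close> with \<open>i\<close> is a (Hausdorff) completion of \<open>(X, U)\<close>: a complete Hausdorff uniform space
  in which \<open>i\<close> embeds \<open>(X, U)\<close> as a dense uniform subspace. It is determined by \<open>(X, U)\<close> up to a
  unique uniform isomorphism commuting with the embeddings.\<close>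

definition uniform_completion ::
    "'a set \<Rightarrow> ('a \<times> 'a) filter \<Rightarrow> 'b set \<Rightarrow> ('b \<times> 'b) filter \<Rightarrow> ('a \<Rightarrow> 'b) \<Rightarrow> bool" where
  "uniform_completion X U Y V i \<longleftrightarrow>
     complete_uniform_space_on Y V \<and>
     Hausdorff_space (uniform_topology Y V) \<and>
     i ` X \<subseteq> Y \<and> inj_on i X \<and>
     U = inf (filtercomap (map_prod i i) V) (principal (X \<times> X)) \<and>
     uniform_topology Y V closure_of (i ` X) = Y"


section \<open>The Rajkov completion\<close>

definition left_uniformity :: "'a monoid \<Rightarrow> 'a topology \<Rightarrow> ('a \<times> 'a) filter" where
  "left_uniformity G T =
     inf (filtercomap (\<lambda>(x, y). inv\<^bsub>G\<^esub> x \<otimes>\<^bsub>G\<^esub> y) (nhdsin T \<one>\<^bsub>G\<^esub>))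
         (principal (carrier G \<times> carrier G))"

definition right_uniformity :: "'a monoid \<Rightarrow> 'a topology \<Rightarrow> ('a \<times> 'a) filter" where
  "right_uniformity G T =
     inf (filtercomap (\<lambda>(x, y). x \<otimes>\<^bsub>G\<^esub> inv\<^bsub>G\<^esub> y) (nhdsin T \<one>\<^bsub>G\<^esub>))
         (principal (carrier G \<times> carrier G))"

text \<open>Filters are ordered with the finer one below, so the join of two uniformities is the
  infimum of the filters.\<close>

definition two_sided_uniformity :: "'a monoid \<Rightarrow> 'a topology \<Rightarrow> ('a \<times> 'a) filter" where
  "two_sided_uniformity G T = inf (left_uniformity G T) (right_uniformity G T)"

text \<open>\<open>(G', T')\<close> with \<open>i : G \<rightarrow> G'\<close> is the Rajkov completion of \<open>(G, T)\<close>. Being dense in a Hausdorff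
  group with \<open>i\<close> a homomorphism, \<open>G\<close> determines the operations of \<open>G'\<close>; so \<open>(G', T', i)\<close> is unique
  up to a unique isomorphism of topological groups commuting with the embeddings.\<close>

definition Rajkov_completion ::
    "'a monoid \<Rightarrow> 'a topology \<Rightarrow> 'b monoid \<Rightarrow> 'b topology \<Rightarrow> ('a \<Rightarrow> 'b) \<Rightarrow> bool" where
  "Rajkov_completion G T G' T' i \<longleftrightarrow>
     topological_group G T \<and> topological_group G' T' \<and> i \<in> hom G G' \<and>
     (\<exists>V. uniform_completion (carrier G) (two_sided_uniformity G T) (carrier G') V i \<and>
          T' = uniform_topology (carrier G') V)"


section \<open>Projective universality\<close>

definition countable_metrizable_group :: "'a monoid \<Rightarrow> 'a topology \<Rightarrow> bool" where
  "countable_metrizable_group G T \<longleftrightarrow>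
     topological_group G T \<and> countable (carrier G) \<and> metrizable_space T"

definition Polish_group :: "'a monoid \<Rightarrow> 'a topology \<Rightarrow> bool" where
  "Polish_group G T \<longleftrightarrow>
     topological_group G T \<and> completely_metrizable_space T \<and> separable_space T"

definition is_quotient_of ::
    "'b monoid \<Rightarrow> 'b topology \<Rightarrow> 'a monoid \<Rightarrow> 'a topology \<Rightarrow> bool" where
  "is_quotient_of H S G T \<longleftrightarrow>
     (\<exists>N. N \<lhd> G \<and> closedin T N \<and>
          topological_group_isomorphic (G Mod N) (quotient_group_topology G T N) H S)"

text \<open>Every countable group is isomorphic to one whose carrier is a set of natural numbers, and
  being a quotient is invariant under isomorphism, so letting \<open>H\<close> range over groups
  with carrier in \<^typ>\<open>nat\<close> covers all countable metrizable groups.\<close>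

definition projectively_universal_countable_metrizable_group ::
    "'a monoid \<Rightarrow> 'a topology \<Rightarrow> bool" where
  "projectively_universal_countable_metrizable_group G T \<longleftrightarrow>
     countable_metrizable_group G T \<and>
     (\<forall>(H :: nat monoid) S. countable_metrizable_group H S \<longrightarrow> is_quotient_of H S G T)"

text \<open>A definition cannot quantify over types, so the type \<open>'h\<close> carrying the Polish groups \<open>H\<close> is a
  parameter; with \<open>'h\<close> left free in a theorem's conclusion, all Polish groups are covered.\<close>

definition projectively_universal_Polish_group ::
    "'h itself \<Rightarrow> 'a monoid \<Rightarrow> 'a topology \<Rightarrow> bool" where
  "projectively_universal_Polish_group (_ :: 'h itself) P T \<longleftrightarrow>
     Polish_group P T \<and>
     (\<forall>(H :: 'h monoid) S. Polish_group H S \<longrightarrow> is_quotient_of H S P T)"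

end

theory Submission
  imports Defs "HOL-Algebra.Generated_Groups"
begin

text \<open>
  Let \<open>H\<close> be a Polish group and \<open>D\<close> a countable dense subgroup of it. By hypothesis some continuous
  open homomorphism \<open>f\<close> maps \<open>G\<close> onto \<open>D\<close>. The proof extends \<open>f\<close> to a continuous
  homomorphism \<open>F\<close> from the completion to \<open>H\<close> and shows that \<open>F\<close> is open and onto; then \<open>H\<close> is the
  quotient of the completion by the kernel of \<open>F\<close>.

  \<^emph>\<open>The completion is Polish.\<close> Closures of the entourages of a countable base of \<open>G\<close> form a base of
  the uniformity of the completion (\<open>countably_based_uniform_completion\<close>), and a Hausdorff uniformity
  with a countable base is induced by a metric (\<open>uniform_space_metrization\<close>), for which completeness
  of the uniformity is completeness in the usual sense.

  \<^emph>\<open>The extension exists.\<close> A point \<open>p\<close> of the completion is the limit of a sequence in \<open>G\<close> that is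
  Cauchy for the two-sided uniformity, and \<open>f\<close> maps it to such a sequence in \<open>H\<close>. The latter has a
  limit, because a completely metrizable group is complete in its two-sided uniformity
  (\<open>two_sided_Cauchy_imp_convergent\<close>). The difficulty is that a complete metric of \<open>H\<close> as a space need
  not be related to its uniformities. Baire category overcomes it: for a Cauchy sequence \<open>\<sigma>\<close> and generic
  \<open>x\<close>, the translated sequence \<open>\<sigma> n \<otimes> x\<close> is Cauchy for the complete metric.

  \<^emph>\<open>The extension is open and onto.\<close> One cannot simply lift a Cauchy sequence in \<open>D\<close> step by step to a
  Cauchy sequence in \<open>G\<close>: to control a correction on both sides one must know the group element to
  which it is applied, and this element depends on the corrections made so far. Category helps
  again. If \<open>f\<close> maps \<open>U \<inter> G\<close> onto the trace on \<open>D\<close> of an open set \<open>W\<close>, then \<open>F ` U\<close> contains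
  a residual part of \<open>W\<close> (\<open>residual_image\<close>): a generic point of \<open>W\<close> stays in the corresponding open
  set when \<open>U\<close> is replaced by one of countably many small balls inside it, again and again. As in
  the theorem of Pettis, the quotients of two elements of a residual part of \<open>W\<close> contain a
  neighbourhood of the unit
  (\<open>open_surjective_homomorphism\<close>).
\<close>

section \<open>A metric from a weak triangle inequality\<close>

fun path_length :: "('a \<Rightarrow> 'a \<Rightarrow> real) \<Rightarrow> 'a \<Rightarrow> 'a list \<Rightarrow> real" where
  "path_length w x [] = 0"
| "path_length w x (y # ys) = w x y + path_length w y ys"

text \<open>The largest pseudometric below \<open>w\<close>, when \<open>w\<close> is nonnegative, symmetric and zero on
  the diagonal.\<close>

definition chain_dist :: "('a \<Rightarrow> 'a \<Rightarrow> real) \<Rightarrow> 'a \<Rightarrow> 'a \<Rightarrow> real" where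
  "chain_dist w x y = (INF ys\<in>{ys. last (x # ys) = y}. path_length w x ys)"

lemma path_length_append:
  "path_length w x (ys @ zs) = path_length w x ys + path_length w (last (x # ys)) zs"
  by (induction ys arbitrary: x) auto

lemma path_length_rev:
  assumes "\<And>x y. w x y = w y x"
  shows "path_length w (last (x # ys)) (tl (rev (x # ys))) = path_length w x ys"
proof (induction ys arbitrary: x)
  case (Cons y ys)
  have "tl (rev (x # y # ys)) = tl (rev (y # ys)) @ [x]"
    by (cases "rev ys") auto
  moreover have "last (last (y # ys) # tl (rev (y # ys))) = y"
    by (cases ys rule: rev_cases) auto
  ultimately show ?case
    using Cons.IH[of y] assms[of x y] by (simp add: path_length_append)
qed simp

text \<open>The weak triangle inequality is what a sequence of symmetric entourages, the threefold composite of
  each contained in its predecessor, gives for the function \<open>2\<^sup>-\<^sup>n\<close> recording the first \<open>n\<close> at which two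
  points are separated.\<close>

locale premetric =
  fixes w :: "'a \<Rightarrow> 'a \<Rightarrow> real"
  assumes nonneg: "0 \<le> w x y"
    and refl: "w x x = 0"
    and sym: "w x y = w y x"
    and weak_triangle: "w x y \<le> 2 * max (w x a) (max (w a b) (w b y))"
begin

lemma path_length_nonneg: "0 \<le> path_length w x ys"
  by (induction ys arbitrary: x) (auto simp: nonneg)

text \<open>A path can be cut at one edge so that the two remaining pieces have lengths at most \<open>t\<close> and the rest:
  cut at the edge during which the length first exceeds \<open>t\<close>, or at the last edge.\<close>

lemma halve_path:
  assumes "ys \<noteq> []" "0 \<le> t" "t \<le> path_length w x ys"
  shows "\<exists>as b bs. ys = as @ b # bs \<and> path_length w x as \<le> t \<and>
           path_length w b bs \<le> path_length w x ys - t"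
  using assms
proof (induction ys arbitrary: x t)
  case (Cons y ys)
  show ?case
  proof (cases "t < w x y \<or> ys = []")
    case True
    then have "path_length w y ys \<le> path_length w x (y # ys) - t"
      using Cons.prems by auto
    then show ?thesis
      using Cons.prems by (intro exI[of _ "[]"]) auto
  next
    case False
    then obtain as b bs where "ys = as @ b # bs" "path_length w y as \<le> t - w x y"
      "path_length w b bs \<le> path_length w y ys - (t - w x y)"
      using Cons.IH[of "t - w x y" y] Cons.prems by auto
    then show ?thesis
      by (intro exI[of _ "y # as"] exI[of _ b] exI[of _ bs]) auto
  qed
qed simp

text \<open>Frink's metrization lemma. Cut the path at an edge \<open>ab\<close> so that both pieces have at most half of the
  length \<open>s\<close>. By induction \<open>w\<close> is at most \<open>s\<close> between the ends of each piece, and \<open>w a b \<le> s\<close> because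
  \<open>ab\<close> is part of the path; the weak triangle inequality gives \<open>2 s\<close>.\<close>

lemma le_twice_path_length: "w x (last (x # ys)) \<le> 2 * path_length w x ys"
proof (induction "length ys" arbitrary: x ys rule: less_induct)
  case less
  show ?case
  proof (cases "ys = []")
    case False
    let ?s = "path_length w x ys"
    obtain as b bs where ys: "ys = as @ b # bs" and as: "path_length w x as \<le> ?s / 2"
      and bs: "path_length w b bs \<le> ?s - ?s / 2"
      using halve_path[OF False, of "?s / 2" x] path_length_nonneg[of x ys] by auto
    let ?a = "last (x # as)"
    have "?s = path_length w x as + w ?a b + path_length w b bs"
      by (simp add: ys path_length_append)
    then have "w ?a b \<le> ?s"
      using path_length_nonneg[of x as] path_length_nonneg[of b bs] by linarith
    moreover have "w x ?a \<le> ?s" "w b (last (b # bs)) \<le> ?s"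
      using less[of as x] less[of bs b] as bs ys by auto
    moreover have "last (x # ys) = last (b # bs)"
      by (simp add: ys)
    ultimately show ?thesis
      using weak_triangle[of x "last (b # bs)" ?a b] by (simp add: max_def split: if_splits)
  qed (simp add: refl)
qed

lemma bdd_below_path_length: "bdd_below (path_length w x ` A)"
  using path_length_nonneg by (intro bdd_belowI2[of _ 0]) auto

lemma chain_dist_le_path_length: "last (x # ys) = y \<Longrightarrow> chain_dist w x y \<le> path_length w x ys"
  unfolding chain_dist_def by (rule cINF_lower[OF bdd_below_path_length]) simp

lemma chain_dist_greatest:
  assumes "\<And>ys. last (x # ys) = y \<Longrightarrow> c \<le> path_length w x ys"
  shows "c \<le> chain_dist w x y"
proof -
  have "last (x # [y]) = y" by simp
  then show ?thesis
    unfolding chain_dist_def using assms by (intro cINF_greatest) blast+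
qed

lemma chain_dist_le: "chain_dist w x y \<le> w x y"
  using chain_dist_le_path_length[of x "[y]" y] by simp

lemma le_twice_chain_dist: "w x y \<le> 2 * chain_dist w x y"
proof -
  have "w x y / 2 \<le> chain_dist w x y"
  proof (rule chain_dist_greatest)
    fix ys assume "last (x # ys) = y"
    then show "w x y / 2 \<le> path_length w x ys"
      using le_twice_path_length[of x ys] by auto
  qed
  then show ?thesis by simp
qed

lemma chain_dist_triangle: "chain_dist w x z \<le> chain_dist w x y + chain_dist w y z"
proof -
  have "chain_dist w x z - chain_dist w y z \<le> path_length w x ys" if ys: "last (x # ys) = y" for ys
  proof -
    have "chain_dist w x z - path_length w x ys \<le> path_length w y zs" if "last (y # zs) = z" for zs
    proof -
      have "last (x # ys @ zs) = z" using ys that by (auto split: if_splits)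
      then show ?thesis
        using chain_dist_le_path_length[of x "ys @ zs" z] ys by (simp add: path_length_append)
    qed
    then have "chain_dist w x z - path_length w x ys \<le> chain_dist w y z"
      by (rule chain_dist_greatest)
    then show ?thesis by simp
  qed
  then have "chain_dist w x z - chain_dist w y z \<le> chain_dist w x y"
    by (rule chain_dist_greatest)
  then show ?thesis by simp
qed

lemma chain_dist_commute: "chain_dist w x y = chain_dist w y x"
proof -
  have "chain_dist w y x \<le> chain_dist w x y" for x y
  proof (rule chain_dist_greatest)
    fix ys assume ys: "last (x # ys) = y"
    have "last (y # tl (rev (x # ys))) = x"
      using ys by (cases ys rule: rev_cases) auto
    then show "chain_dist w y x \<le> path_length w x ys"
      using chain_dist_le_path_length[of y "tl (rev (x # ys))" x] path_length_rev[where w = w and x = x and ys = ys, OF sym] ys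
      by metis
  qed
  then show ?thesis by (simp add: order_antisym)
qed

lemma Metric_space_chain_dist:
  assumes "\<And>x y. \<lbrakk>x \<in> X; y \<in> X; w x y = 0\<rbrakk> \<Longrightarrow> x = y"
  shows "Metric_space X (chain_dist w)"
proof
  show "0 \<le> chain_dist w x y" for x y
    using nonneg[of x y] le_twice_chain_dist[of x y] by simp
  show "chain_dist w x y = 0 \<longleftrightarrow> x = y" if "x \<in> X" "y \<in> X" for x y
    using assms[of x y] that nonneg[of x y] le_twice_chain_dist[of x y] chain_dist_le[of x x]
      le_twice_chain_dist[of x x] refl[of x] by auto
qed (rule chain_dist_commute chain_dist_triangle)+

end

section \<open>Uniformities with a countable base\<close>

text \<open>Each \<open>E n\<close> is itself large, as the case \<open>P = E n\<close> shows; so the \<open>E n\<close> form a filter base.\<close>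

definition countably_based :: "'a filter \<Rightarrow> bool" where
  "countably_based F \<longleftrightarrow>
     (\<exists>E :: nat \<Rightarrow> 'a \<Rightarrow> bool. \<forall>P. eventually P F \<longleftrightarrow> (\<exists>n. \<forall>z. E n z \<longrightarrow> P z))"

lemma topspace_uniform_topology:
  assumes "uniform_space_on X U"
  shows "topspace (uniform_topology X U) = X"
proof
  have "eventually (\<lambda>z. z \<in> X \<times> X) U"
    using assms by (auto simp: uniform_space_on_def le_principal)
  then have "openin (uniform_topology X U) X"
    unfolding openin_uniform_topology by (auto elim!: eventually_mono)
  then show "X \<subseteq> topspace (uniform_topology X U)"
    by (rule openin_subset)
  show "topspace (uniform_topology X U) \<subseteq> X"
    using openin_topspace[of "uniform_topology X U"] unfolding openin_uniform_topology by blast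
qed

text \<open>The halving axiom applied twice and symmetrized. The shorter composition rules follow from the
  threefold one by reflexivity on \<open>X\<close> and are listed for convenience.\<close>

lemma entourage_shrink:
  assumes U: "uniform_space_on X U" and E: "eventually E U"
  obtains D where "eventually D U" "\<And>x y. D (x, y) \<Longrightarrow> D (y, x)" "\<And>x y. D (x, y) \<Longrightarrow> x \<in> X \<and> y \<in> X"
    "\<And>x y z u. \<lbrakk>D (x, y); D (y, z); D (z, u)\<rbrakk> \<Longrightarrow> E (x, u)"
    "\<And>x y z. \<lbrakk>D (x, y); D (y, z)\<rbrakk> \<Longrightarrow> E (x, z)"
    "\<And>x y. D (x, y) \<Longrightarrow> E (x, y)"
proof -
  have halve: "\<exists>D. eventually D U \<and> (\<forall>x y z. D (x, y) \<longrightarrow> D (y, z) \<longrightarrow> E (x, z))"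
    if "eventually E U" for E
    using U that unfolding uniform_space_on_def by simp
  obtain D1 where D1: "eventually D1 U" "\<And>x y z. D1 (x, y) \<Longrightarrow> D1 (y, z) \<Longrightarrow> E (x, z)"
    using halve[OF E] by blast
  obtain D2 where D2: "eventually D2 U" "\<And>x y z. D2 (x, y) \<Longrightarrow> D2 (y, z) \<Longrightarrow> D1 (x, z)"
    using halve[OF D1(1)] by blast
  have refl: "D1 (x, x)" "D2 (x, x)" if "x \<in> X" for x
    using U D1(1) D2(1) that unfolding uniform_space_on_def by auto
  have D2sym: "eventually (\<lambda>(x, y). D2 (y, x)) U"
    using U D2(1) unfolding uniform_space_on_def by auto
  have UX: "eventually (\<lambda>z. z \<in> X \<times> X) U"
    using U by (auto simp: uniform_space_on_def le_principal)
  define D where "D = (\<lambda>(x, y). D2 (x, y) \<and> D2 (y, x) \<and> x \<in> X \<and> y \<in> X)"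
  have D_D1: "D1 (x, y)" if "D (x, y)" for x y
    using that D2(2)[of x x y] refl by (auto simp: D_def)
  show thesis
  proof
    show "eventually D U"
      using D2(1) D2sym UX by eventually_elim (auto simp: D_def)
    show "D (x, y) \<Longrightarrow> D (y, x)" for x y by (simp add: D_def)
    show "D (x, y) \<Longrightarrow> x \<in> X \<and> y \<in> X" for x y by (simp add: D_def)
    show "E (x, u)" if "D (x, y)" "D (y, z)" "D (z, u)" for x y z u
      using D1(2)[of x z u] D2(2)[of x y z] D_D1[of z u] that by (auto simp: D_def)
    show "E (x, z)" if "D (x, y)" "D (y, z)" for x y z
      using D1(2)[of x y z] D_D1 that by blast
    show "E (x, y)" if "D (x, y)" for x y
      using D1(2)[of x y y] D_D1[of x y] refl that by (auto simp: D_def)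
  qed
qed

text \<open>Choose symmetric entourages \<open>D n\<close> such that the threefold composite of \<open>D (Suc n)\<close> lies in \<open>D n\<close> and
  \<open>D (Suc n)\<close> lies, off the diagonal, in the \<open>n\<close>-th basic entourage. Then
  \<open>w x y = 2\<^sup>-\<^sup>n\<close>, for the first \<open>n\<close> with \<open>(x, y)\<close> outside \<open>D n\<close>, satisfies the weak
  triangle inequality, and the chain distance of \<open>w\<close> lies between \<open>w / 2\<close> and \<open>w\<close>, so both
  define the same entourages.\<close>

theorem uniform_space_metrization:
  assumes U: "uniform_space_on X U" and base: "countably_based U"
    and Haus: "Hausdorff_space (uniform_topology X U)"
  shows "\<exists>d. Metric_space X d \<and>
    (\<forall>P. eventually P U \<longleftrightarrow> (\<exists>r>0. \<forall>x\<in>X. \<forall>y\<in>X. d x y < r \<longrightarrow> P (x, y)))"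
proof -
  obtain E :: "nat \<Rightarrow> 'a \<times> 'a \<Rightarrow> bool"
    where E: "\<And>P. eventually P U \<longleftrightarrow> (\<exists>n. \<forall>z. E n z \<longrightarrow> P z)"
    using base unfolding countably_based_def by blast
  have E_ev: "eventually (E n) U" for n
    unfolding E by blast
  have U_refl: "P (x, x)" if "eventually P U" "x \<in> X" for P x
    using U that unfolding uniform_space_on_def by auto
  \<comment> \<open>Reflexivity is required on the whole type, so that the chain distance can be built from paths
    through arbitrary points.\<close>
  define good where "good D \<longleftrightarrow> eventually (\<lambda>(x, y). D x y) U \<and>
      (\<forall>x. D x x) \<and> (\<forall>x y. D x y \<longrightarrow> D y x)" for D
  define fits where "fits n D D' \<longleftrightarrow> (\<forall>x y z u. D' x y \<longrightarrow> D' y z \<longrightarrow> D' z u \<longrightarrow> D x u) \<and>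
      (\<forall>x y. D' x y \<longrightarrow> x = y \<or> E n (x, y))" for n and D D' :: "'a \<Rightarrow> 'a \<Rightarrow> bool"
  have "\<exists>D. \<forall>n. good (D n) \<and> fits n (D n) (D (Suc n))"
  proof (rule dependent_nat_choice[where P = "\<lambda>_. good"])
    show "\<exists>D. good D"
      by (rule exI[of _ "\<lambda>_ _. True"]) (simp add: good_def case_prod_unfold)
    fix D n assume D: "good D"
    then have DE: "eventually (\<lambda>(x, y). D x y \<and> E n (x, y)) U"
      using E_ev[of n] unfolding good_def by (auto elim: eventually_elim2)
    obtain C where C: "eventually C U" "\<And>x y. C (x, y) \<Longrightarrow> C (y, x)"
      "\<And>x y z u. \<lbrakk>C (x, y); C (y, z); C (z, u)\<rbrakk> \<Longrightarrow> D x u \<and> E n (x, u)"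
      "\<And>x y z. \<lbrakk>C (x, y); C (y, z)\<rbrakk> \<Longrightarrow> D x z \<and> E n (x, z)"
      "\<And>x y. C (x, y) \<Longrightarrow> D x y \<and> E n (x, y)"
      by (rule entourage_shrink[OF U DE, unfolded prod.case]) blast
    define D' where "D' x y \<longleftrightarrow> x = y \<or> C (x, y)" for x y
    have "good D'"
      using C(1,2) unfolding good_def D'_def by (auto elim: eventually_mono)
    moreover have "fits n D D'"
      unfolding fits_def D'_def using C(3-5) D[unfolded good_def] by metis
    ultimately show "\<exists>D'. good D' \<and> fits n D D'" by blast
  qed
  then obtain D where D: "\<And>n. good (D n)" "\<And>n. fits n (D n) (D (Suc n))" by blast
  have D_refl: "D n x x" and D_sym: "D n x y \<longleftrightarrow> D n y x"
    and D_ev: "eventually (\<lambda>(x, y). D n x y) U" for n x y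
    using D(1)[of n] unfolding good_def by blast+
  have D3: "D (Suc n) x y \<Longrightarrow> D (Suc n) y z \<Longrightarrow> D (Suc n) z u \<Longrightarrow> D n x u"
    and DE: "D (Suc n) x y \<Longrightarrow> x = y \<or> E n (x, y)" for n x y z u
    using D(2)[of n] unfolding fits_def by blast+
  have D_mono: "D m x y" if "D n x y" "m \<le> n" for m n x y
    using that(2,1) by (induction rule: dec_induct) (auto intro: D3 D_refl)
  define w where "w x y = (if \<forall>n. D n x y then 0 else (1/2) ^ (LEAST n. \<not> D n x y) :: real)" for x y
  have w_le_iff: "w x y \<le> (1/2) ^ Suc n \<longleftrightarrow> D n x y" for x y n
  proof (cases "\<forall>n. D n x y")
    case False
    let ?m = "LEAST n. \<not> D n x y"
    have "\<not> D ?m x y" using False by (metis (mono_tags, lifting) LeastI_ex)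
    then have "D n x y \<longleftrightarrow> n < ?m"
      using D_mono not_less_Least by (metis not_le_imp_less)
    moreover have "(1/2::real) ^ ?m \<le> (1/2) ^ Suc n \<longleftrightarrow> Suc n \<le> ?m"
      by (rule power_decreasing_iff) auto
    moreover have "w x y = (1/2) ^ ?m"
      using False by (simp only: w_def if_False)
    ultimately show ?thesis by (simp add: less_eq_Suc_le)
  qed (simp add: w_def)
  have w_values: "w x y = 0 \<or> (\<exists>n. w x y = (1/2) ^ n)" for x y
    by (auto simp: w_def)
  interpret premetric w
  proof
    show "0 \<le> w x y" for x y by (simp add: w_def)
    show "w x x = 0" for x by (simp add: w_def D_refl)
    show "w x y = w y x" for x y using D_sym[of _ x y] by (simp add: w_def)
    show "w x y \<le> 2 * max (w x a) (max (w a b) (w b y))" for x y a b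
    proof -
      let ?M = "max (w x a) (max (w a b) (w b y))"
      have M: "w x a \<le> ?M" "w a b \<le> ?M" "w b y \<le> ?M" by auto
      consider "?M = 0" | "?M = 1" | n where "?M = (1/2) ^ Suc n"
      proof -
        have "?M = 0 \<or> (\<exists>n. ?M = (1/2) ^ n)"
          using w_values[of x a] w_values[of a b] w_values[of b y] by (smt (verit))
        then show thesis using that by (metis not0_implies_Suc power_0)
      qed
      then show ?thesis
      proof cases
        case 1
        have "D n x a \<and> D n a b \<and> D n b y" for n
          using M unfolding 1 by (meson order_trans w_le_iff zero_le_divide_1_iff zero_le_numeral zero_le_power)
        then have "D n x y" for n using D3 by blast
        then show ?thesis using 1 by (simp add: w_def)
      next
        case 2
        have "w x y \<le> 1" by (simp add: w_def power_le_one)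
        then show ?thesis using 2 by simp
      next
        case (3 n)
        have *: "D n x a" "D n a b" "D n b y"
          using M unfolding 3 w_le_iff by auto
        show ?thesis
        proof (cases n)
          case 0
          have "w x y \<le> 1" by (simp add: w_def power_le_one)
          then show ?thesis using 3 0 by simp
        next
          case (Suc m)
          then have "w x y \<le> (1/2) ^ Suc m"
            using D3 * w_le_iff by blast
          then show ?thesis using 3 Suc by simp
        qed
      qed
    qed
  qed
  have dist_iff: "eventually P U \<longleftrightarrow> (\<exists>r>0. \<forall>x\<in>X. \<forall>y\<in>X. chain_dist w x y < r \<longrightarrow> P (x, y))"
    (is "_ \<longleftrightarrow> ?R") for P
  proof
    assume P: "eventually P U"
    then obtain n where n: "\<And>z. E n z \<Longrightarrow> P z" unfolding E by blast
    show ?R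
    proof (intro exI[of _ "(1/2) ^ Suc (Suc (Suc n))"] conjI ballI impI)
      fix x y assume xy: "x \<in> X" "y \<in> X" "chain_dist w x y < (1/2) ^ Suc (Suc (Suc n))"
      then have "w x y \<le> (1/2) ^ Suc (Suc n)"
        using le_twice_chain_dist[of x y] by simp
      then have "x = y \<or> E n (x, y)" using w_le_iff DE by blast
      then show "P (x, y)" using n U_refl[OF P] xy by blast
    qed simp
  next
    assume ?R
    then obtain r where r: "r > 0" "\<And>x y. \<lbrakk>x \<in> X; y \<in> X; chain_dist w x y < r\<rbrakk> \<Longrightarrow> P (x, y)"
      by blast
    obtain n where n: "(1/2) ^ n < r" using r(1) real_arch_pow_inv[of r "1/2"] by auto
    have "(1/2) ^ Suc n < r" using n r(1) by (simp add: field_simps)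
    then have *: "chain_dist w x y < r" if "D n x y" for x y
      using that chain_dist_le[of x y] w_le_iff by (meson le_less_trans)
    have "eventually (\<lambda>z. z \<in> X \<times> X) U"
      using U by (auto simp: uniform_space_on_def le_principal)
    then show "eventually P U"
      using D_ev[of n] by eventually_elim (auto intro: r(2) *)
  qed
  have "Metric_space X (chain_dist w)"
  proof (rule Metric_space_chain_dist, rule ccontr)
    fix x y assume xy: "x \<in> X" "y \<in> X" "w x y = 0" "x \<noteq> y"
    then obtain A B where AB: "openin (uniform_topology X U) A" "x \<in> A" "y \<in> B" "disjnt A B"
      using Haus topspace_uniform_topology[OF U] unfolding Hausdorff_space_def by metis
    then have "eventually (\<lambda>(x', y). x' = x \<longrightarrow> y \<in> A) U"
      unfolding openin_uniform_topology by blast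
    then have "y \<in> A"
      using xy chain_dist_le[of x y] unfolding dist_iff by fastforce
    then show False using AB by (auto simp: disjnt_iff)
  qed
  with dist_iff show ?thesis by blast
qed

text \<open>A Cauchy sequence of the metric generates a Cauchy filter of the uniformity.\<close>

lemma complete_uniform_space_completely_metrizable:
  assumes U: "complete_uniform_space_on X U" and base: "countably_based U"
    and Haus: "Hausdorff_space (uniform_topology X U)"
  shows "completely_metrizable_space (uniform_topology X U)"
proof -
  have unif: "uniform_space_on X U"
    using U by (simp add: complete_uniform_space_on_def)
  obtain d where "Metric_space X d"
    and d: "\<And>P. eventually P U \<longleftrightarrow> (\<exists>r>0. \<forall>x\<in>X. \<forall>y\<in>X. d x y < r \<longrightarrow> P (x, y))"
    using uniform_space_metrization[OF unif base Haus] by blast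
  then interpret Metric_space X d by simp
  have top: "uniform_topology X U = mtopology"
    unfolding topology_eq
  proof
    fix W
    have "(\<exists>r>0. \<forall>x'\<in>X. \<forall>y\<in>X. d x' y < r \<longrightarrow> x' = x \<longrightarrow> y \<in> W) \<longleftrightarrow> (\<exists>r>0. mball x r \<subseteq> W)"
      if "x \<in> X" for x
      using that by (auto simp: subset_iff)
    then have "W \<subseteq> X \<and> (\<forall>x\<in>W. \<exists>r>0. \<forall>x'\<in>X. \<forall>y\<in>X. d x' y < r \<longrightarrow> x' = x \<longrightarrow> y \<in> W) \<longleftrightarrow>
        W \<subseteq> X \<and> (\<forall>x\<in>W. \<exists>r>0. mball x r \<subseteq> W)"
      by (intro conj_cong ball_cong refl) auto
    then show "openin (uniform_topology X U) W \<longleftrightarrow> openin mtopology W"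
      unfolding openin_uniform_topology openin_mtopology d prod.case by blast
  qed
  have mcomplete
    unfolding mcomplete_def
  proof (intro allI impI)
    fix \<sigma> assume \<sigma>: "MCauchy \<sigma>"
    let ?F = "filtermap \<sigma> sequentially"
    have "?F \<noteq> bot" by (simp add: filtermap_bot_iff)
    moreover have "?F \<le> principal X"
      using \<sigma> by (auto simp: MCauchy_def le_principal eventually_filtermap intro!: always_eventually)
    moreover have "?F \<times>\<^sub>F ?F \<le> U"
    proof (rule filter_leI)
      fix P assume "eventually P U"
      then obtain r where r: "r > 0" "\<And>x y. \<lbrakk>x \<in> X; y \<in> X; d x y < r\<rbrakk> \<Longrightarrow> P (x, y)"
        unfolding d by blast
      obtain N where N: "\<And>n m. N \<le> n \<Longrightarrow> N \<le> m \<Longrightarrow> d (\<sigma> n) (\<sigma> m) < r"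
        using \<sigma> r(1) unfolding MCauchy_def by meson
      have "eventually (\<lambda>x. x \<in> \<sigma> ` {N..}) ?F"
        by (auto simp: eventually_filtermap eventually_sequentially)
      moreover have "P (x, y)" if "x \<in> \<sigma> ` {N..}" "y \<in> \<sigma> ` {N..}" for x y
        using that \<sigma> by (auto intro!: r(2) N simp: MCauchy_def)
      ultimately show "eventually P (?F \<times>\<^sub>F ?F)"
        unfolding eventually_prod_filter by blast
    qed
    ultimately obtain x where x: "x \<in> X" "?F \<le> nhdsin mtopology x"
      using U unfolding complete_uniform_space_on_def top by blast
    have "limitin mtopology \<sigma> x sequentially"
      unfolding limitin_def
    proof (intro conjI allI impI)
      fix W assume "openin mtopology W \<and> x \<in> W"
      then have "eventually (\<lambda>y. y \<in> W) (nhdsin mtopology x)"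
        unfolding eventually_nhdsin by blast
      then have "eventually (\<lambda>y. y \<in> W) ?F"
        by (rule filter_leD[OF x(2)])
      then show "eventually (\<lambda>n. \<sigma> n \<in> W) sequentially"
        by (simp add: eventually_filtermap)
    qed (use x in simp)
    then show "\<exists>x. limitin mtopology \<sigma> x sequentially" by blast
  qed
  then show ?thesis
    unfolding top by (rule completely_metrizable_space_mtopology)
qed

text \<open>The sets \<open>{y. E (x, y)}\<close> need not be open. The points for which such a set is still a neighbourhood
  in the sense of entourages form an open subset, by the halving axiom.\<close>

lemma entourage_contains_neighbourhood:
  assumes U: "uniform_space_on X U" and E: "eventually E U" and x: "x \<in> X"
  obtains W where "openin (uniform_topology X U) W" "x \<in> W" "\<And>y. y \<in> W \<Longrightarrow> E (x, y)"
proof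
  define W where "W = {z \<in> X. eventually (\<lambda>(z', y). z' = z \<longrightarrow> E (x, y)) U}"
  have refl: "P (x, x)" if "eventually P U" "x \<in> X" for P x
    using U that unfolding uniform_space_on_def by auto
  show "x \<in> W"
    unfolding W_def using x E by (auto elim: eventually_mono)
  show "E (x, y)" if "y \<in> W" for y
    using that refl unfolding W_def by fastforce
  show "openin (uniform_topology X U) W"
    unfolding openin_uniform_topology
  proof (intro conjI ballI)
    fix z assume "z \<in> W"
    then have z: "z \<in> X" and "eventually (\<lambda>(z', y). z' = z \<longrightarrow> E (x, y)) U"
      unfolding W_def by auto
    from this(2) obtain D where D: "eventually D U" "\<And>x y. D (x, y) \<Longrightarrow> x \<in> X \<and> y \<in> X"
      "\<And>a b c. \<lbrakk>D (a, b); D (b, c)\<rbrakk> \<Longrightarrow> a = z \<longrightarrow> E (x, c)"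
      by (rule entourage_shrink[OF U, unfolded prod.case]) blast
    have "v \<in> W" if "D (z, v)" for v
      unfolding W_def using D that by (auto elim!: eventually_mono)
    then show "eventually (\<lambda>(z', y). z' = z \<longrightarrow> y \<in> W) U"
      using D(1) by (auto elim!: eventually_mono)
  qed (auto simp: W_def)
qed

text \<open>The closures of the images of the basic entourages \<open>E n\<close> generate \<open>V\<close>. Each is an entourage, since
  points that are close can be approximated by images of points that are close; and they are small,
  since \<open>V\<close> restricts to \<open>U\<close> and closing up a set enlarges it by an arbitrarily small entourage only.\<close>

lemma countably_based_uniform_completion:
  assumes compl: "uniform_completion X U Y V i" and base: "countably_based U"
  shows "countably_based V"
proof -
  have V: "uniform_space_on Y V"
    and U_def: "U = inf (filtercomap (map_prod i i) V) (principal (X \<times> X))"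
    and dense: "uniform_topology Y V closure_of (i ` X) = Y"
    using compl unfolding uniform_completion_def complete_uniform_space_on_def by auto
  have U_iff: "eventually P U \<longleftrightarrow> (\<exists>Q. eventually Q V \<and> (\<forall>a\<in>X. \<forall>b\<in>X. Q (i a, i b) \<longrightarrow> P (a, b)))" for P
    unfolding U_def by (auto simp: eventually_inf_principal eventually_filtercomap)
  have approx: "\<exists>a\<in>X. D (x, i a)" if D: "eventually D V" and x: "x \<in> Y" for D x
  proof -
    obtain W where "openin (uniform_topology Y V) W" "x \<in> W" "\<And>y. y \<in> W \<Longrightarrow> D (x, y)"
      using entourage_contains_neighbourhood[OF V D x] by blast
    then show ?thesis using x dense unfolding closure_of_def by blast
  qed
  obtain E :: "nat \<Rightarrow> 'a \<times> 'a \<Rightarrow> bool"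
    where E: "\<And>P. eventually P U \<longleftrightarrow> (\<exists>n. \<forall>z. E n z \<longrightarrow> P z)"
    using base unfolding countably_based_def by blast
  \<comment> \<open>The closure of the image of \<open>E n\<close>, with nearness to a point expressed by entourages.\<close>
  define C where "C n = (\<lambda>(x, y). x \<in> Y \<and> y \<in> Y \<and> (\<forall>D. eventually D V \<longrightarrow>
      (\<exists>a\<in>X. \<exists>b\<in>X. E n (a, b) \<and> D (x, i a) \<and> D (y, i b))))" for n
  have C_ev: "eventually (C n) V" for n
  proof -
    have "eventually (E n) U" unfolding E by blast
    then obtain Q where Q: "eventually Q V" "\<And>a b. \<lbrakk>a \<in> X; b \<in> X; Q (i a, i b)\<rbrakk> \<Longrightarrow> E n (a, b)"
      unfolding U_iff by blast
    obtain D where D: "eventually D V" "\<And>x y. D (x, y) \<Longrightarrow> D (y, x)" "\<And>x y. D (x, y) \<Longrightarrow> x \<in> Y \<and> y \<in> Y"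
      "\<And>x y z u. \<lbrakk>D (x, y); D (y, z); D (z, u)\<rbrakk> \<Longrightarrow> Q (x, u)"
      by (rule entourage_shrink[OF V Q(1)]) blast
    have "C n (x, y)" if xy: "D (x, y)" for x y
      unfolding C_def prod.case
    proof (intro conjI allI impI)
      fix D' assume "eventually D' V"
      then have ev: "eventually (\<lambda>z. D z \<and> D' z) V" using D(1) by (rule eventually_conj[rotated])
      obtain a b where "a \<in> X" "D (x, i a)" "D' (x, i a)" "b \<in> X" "D (y, i b)" "D' (y, i b)"
        using approx[OF ev] D(3)[OF xy] by metis
      then show "\<exists>a\<in>X. \<exists>b\<in>X. E n (a, b) \<and> D' (x, i a) \<and> D' (y, i b)"
        using Q(2) D(2,4) xy by metis
    qed (use D(3)[OF xy] in auto)
    then show ?thesis using D(1) by (auto elim!: eventually_mono)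
  qed
  have C_base: "\<exists>n. \<forall>z. C n z \<longrightarrow> P z" if P: "eventually P V" for P
  proof -
    obtain D where D: "eventually D V" "\<And>x y. D (x, y) \<Longrightarrow> D (y, x)"
      "\<And>x y z u. \<lbrakk>D (x, y); D (y, z); D (z, u)\<rbrakk> \<Longrightarrow> P (x, u)"
      by (rule entourage_shrink[OF V P]) blast
    have "eventually (\<lambda>(a, b). D (i a, i b)) U"
      unfolding U_iff using D(1) by auto
    then obtain n where n: "\<And>a b. E n (a, b) \<Longrightarrow> D (i a, i b)" unfolding E by auto
    have "P (x, y)" if "C n (x, y)" for x y
    proof -
      have "\<exists>a\<in>X. \<exists>b\<in>X. E n (a, b) \<and> D (x, i a) \<and> D (y, i b)"
        using that D(1) unfolding C_def by auto
      then show ?thesis using n D(2,3) by meson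
    qed
    then show ?thesis by auto
  qed
  have "eventually P V \<longleftrightarrow> (\<exists>n. \<forall>z. C n z \<longrightarrow> P z)" for P
    using C_base C_ev by (meson eventually_mono)
  then show ?thesis unfolding countably_based_def by blast
qed

section \<open>Topological groups and two-sided Cauchy sequences\<close>

context topological_group
begin

lemma carrier_openin: "openin T W \<Longrightarrow> x \<in> W \<Longrightarrow> x \<in> carrier G"
  using openin_subset[of T W] by (auto simp: topspace_eq_carrier)

lemma mult_neighbourhoods:
  assumes "openin T W" "x \<in> carrier G" "y \<in> carrier G" "x \<otimes> y \<in> W"
  obtains U V where "openin T U" "openin T V" "x \<in> U" "y \<in> V" "\<And>u v. \<lbrakk>u \<in> U; v \<in> V\<rbrakk> \<Longrightarrow> u \<otimes> v \<in> W"
proof -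
  let ?P = "{z \<in> topspace (prod_topology T T). (\<lambda>(x, y). x \<otimes> y) z \<in> W}"
  have "openin (prod_topology T T) ?P"
    by (rule openin_continuous_map_preimage[OF continuous_mult assms(1)])
  moreover have "(x, y) \<in> ?P"
    using assms(2-4) topspace_eq_carrier by simp
  ultimately have "\<exists>U V. openin T U \<and> openin T V \<and> x \<in> U \<and> y \<in> V \<and> U \<times> V \<subseteq> ?P"
    unfolding openin_prod_topology_alt by simp
  then obtain U V where UV: "openin T U" "openin T V" "x \<in> U" "y \<in> V" "U \<times> V \<subseteq> ?P"
    by (elim exE conjE)
  show thesis
    by (rule that[OF UV(1-4)]) (use UV(5) in auto)
qed

lemma continuous_left_translation:
  assumes "x \<in> carrier G"
  shows "continuous_map T T (\<lambda>y. x \<otimes> y)"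
proof -
  have "continuous_map T (prod_topology T T) (\<lambda>y. (x, y))"
    using assms topspace_eq_carrier by (intro continuous_map_pairedI) auto
  from continuous_map_compose[OF this continuous_mult] show ?thesis
    by (simp add: o_def)
qed

lemma continuous_right_translation:
  assumes "x \<in> carrier G"
  shows "continuous_map T T (\<lambda>y. y \<otimes> x)"
proof -
  have "continuous_map T (prod_topology T T) (\<lambda>y. (y, x))"
    using assms topspace_eq_carrier by (intro continuous_map_pairedI) auto
  from continuous_map_compose[OF this continuous_mult] show ?thesis
    by (simp add: o_def)
qed

lemma openin_left_translation_preimage:
  "openin T W \<Longrightarrow> x \<in> carrier G \<Longrightarrow> openin T {y \<in> carrier G. x \<otimes> y \<in> W}"
  by (rule openin_continuous_map_preimage[OF continuous_left_translation, unfolded topspace_eq_carrier])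

lemma openin_right_translation_preimage:
  "openin T W \<Longrightarrow> x \<in> carrier G \<Longrightarrow> openin T {y \<in> carrier G. y \<otimes> x \<in> W}"
  by (rule openin_continuous_map_preimage[OF continuous_right_translation, unfolded topspace_eq_carrier])

lemma openin_inv_preimage: "openin T W \<Longrightarrow> openin T {y \<in> carrier G. inv y \<in> W}"
  by (rule openin_continuous_map_preimage[OF continuous_inv, unfolded topspace_eq_carrier])

lemma division_neighbourhood:
  assumes "openin T W" "\<one> \<in> W"
  obtains U where "openin T U" "\<one> \<in> U" "\<And>u v. \<lbrakk>u \<in> U; v \<in> U\<rbrakk> \<Longrightarrow> u \<otimes> inv v \<in> W"
proof -
  obtain U V where UV: "openin T U" "openin T V" "\<one> \<in> U" "\<one> \<in> V"
    "\<And>u v. \<lbrakk>u \<in> U; v \<in> V\<rbrakk> \<Longrightarrow> u \<otimes> v \<in> W"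
    by (rule mult_neighbourhoods[OF assms(1) one_closed one_closed]) (use assms in auto)
  show thesis
    by (rule that[of "U \<inter> {y \<in> carrier G. inv y \<in> V}"])
      (use UV openin_inv_preimage in auto)
qed

end

definition two_sided_Cauchy :: "('a, 'c) monoid_scheme \<Rightarrow> 'a topology \<Rightarrow> (nat \<Rightarrow> 'a) \<Rightarrow> bool" where
  "two_sided_Cauchy G T \<sigma> \<longleftrightarrow> range \<sigma> \<subseteq> carrier G \<and>
     (\<forall>W. openin T W \<longrightarrow> \<one>\<^bsub>G\<^esub> \<in> W \<longrightarrow> (\<exists>N. \<forall>m\<ge>N. \<forall>n\<ge>N.
        inv\<^bsub>G\<^esub> \<sigma> m \<otimes>\<^bsub>G\<^esub> \<sigma> n \<in> W \<and> \<sigma> m \<otimes>\<^bsub>G\<^esub> inv\<^bsub>G\<^esub> \<sigma> n \<in> W))"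

lemma two_sided_CauchyD:
  assumes "two_sided_Cauchy G T \<sigma>" "openin T W" "\<one>\<^bsub>G\<^esub> \<in> W"
  shows "\<exists>N. \<forall>m\<ge>N. \<forall>n\<ge>N. inv\<^bsub>G\<^esub> \<sigma> m \<otimes>\<^bsub>G\<^esub> \<sigma> n \<in> W \<and> \<sigma> m \<otimes>\<^bsub>G\<^esub> inv\<^bsub>G\<^esub> \<sigma> n \<in> W"
  using assms unfolding two_sided_Cauchy_def by simp

context topological_group
begin

text \<open>The points \<open>x\<close> for which \<open>\<sigma> n \<otimes> x\<close> is Cauchy for a complete metric \<open>d\<close> of the space contain a countable
  intersection of sets \<open>R k\<close>: those \<open>x\<close> that have a neighbourhood whose translates by all late \<open>\<sigma> n\<close> lie
  within distance \<open>1 / Suc k\<close> of each other. To see that \<open>R k\<close> is dense, start from \<open>x0\<close>, put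
  \<open>y = \<sigma> N \<otimes> x0\<close> and take \<open>x = inv \<sigma> K \<otimes> y\<close> with \<open>K\<close> large. The left Cauchy property makes \<open>x\<close> close to
  \<open>x0\<close>, and the right one keeps \<open>\<sigma> m \<otimes> x = (\<sigma> m \<otimes> inv \<sigma> K) \<otimes> y\<close> close to \<open>y\<close>. One generic \<open>x\<close> suffices: if
  \<open>\<sigma> n \<otimes> x\<close> converges, so does \<open>\<sigma> n\<close>.\<close>

theorem two_sided_Cauchy_imp_convergent:
  assumes compl: "completely_metrizable_space T" and \<sigma>: "two_sided_Cauchy G T \<sigma>"
  shows "\<exists>l. limitin T \<sigma> l sequentially"
proof -
  obtain M d where "Metric_space M d" and mcompl: "Metric_space.mcomplete M d"
    and T: "T = Metric_space.mtopology M d"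
    using compl unfolding completely_metrizable_space_def by blast
  then interpret Metric_space M d by simp
  have M: "M = carrier G"
    using topspace_eq_carrier T by simp
  have \<sigma>_carrier: "\<sigma> n \<in> carrier G" for n
    using \<sigma> unfolding two_sided_Cauchy_def by blast
  define steady where "steady k U \<longleftrightarrow> openin T U \<and>
      (\<exists>N. \<forall>m\<ge>N. \<forall>n\<ge>N. \<forall>u\<in>U. \<forall>v\<in>U. d (\<sigma> m \<otimes> u) (\<sigma> n \<otimes> v) < 1 / real (Suc k))" for k U
  define R where "R k = \<Union>(Collect (steady k))" for k
  have R_open: "openin T (R k)" for k
    unfolding R_def steady_def by auto
  have R_dense: "T closure_of (R k) = topspace T" for k
    unfolding dense_intersects_open
  proof (intro allI impI)
    fix W assume W: "openin T W \<and> W \<noteq> {}"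
    then obtain x0 where x0: "x0 \<in> W" "x0 \<in> carrier G"
      using carrier_openin by blast
    have "openin T {z \<in> carrier G. z \<otimes> x0 \<in> W}" "\<one> \<in> {z \<in> carrier G. z \<otimes> x0 \<in> W}"
      using W x0 openin_right_translation_preimage by auto
    from two_sided_CauchyD[OF \<sigma> this]
    obtain N where N: "\<And>m n. N \<le> m \<Longrightarrow> N \<le> n \<Longrightarrow> (inv \<sigma> m \<otimes> \<sigma> n) \<otimes> x0 \<in> W"
      by blast
    define y where "y = \<sigma> N \<otimes> x0"
    have y: "y \<in> carrier G" using \<sigma>_carrier x0 by (simp add: y_def)
    define r where "r = 1 / real (Suc k) / 2"
    let ?B = "mball y r"
    have "y \<in> M" using y M by simp
    then have B: "openin T ?B" "\<one> \<otimes> y \<in> ?B"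
      unfolding T using y by (simp_all add: r_def)
    obtain U1 U2 where U: "openin T U1" "openin T U2" "\<one> \<in> U1" "y \<in> U2"
      "\<And>u v. \<lbrakk>u \<in> U1; v \<in> U2\<rbrakk> \<Longrightarrow> u \<otimes> v \<in> ?B"
      by (rule mult_neighbourhoods[OF B(1) one_closed y B(2)]) (rule that)
    obtain L where L: "\<And>m n. L \<le> m \<Longrightarrow> L \<le> n \<Longrightarrow> \<sigma> m \<otimes> inv \<sigma> n \<in> U1"
      using two_sided_CauchyD[OF \<sigma> U(1,3)] by blast
    \<comment> \<open>From \<open>N\<close> on the left quotients are small enough for \<open>W\<close>, from \<open>L\<close> on the right ones for \<open>?B\<close>.\<close>
    define K where "K = max N L"
    define U where "U = {u \<in> carrier G. \<sigma> K \<otimes> u \<in> U2}"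
    have in_ball: "\<sigma> m \<otimes> u \<in> ?B" if "K \<le> m" "u \<in> U" for m u
    proof -
      have "\<sigma> m \<otimes> u = (\<sigma> m \<otimes> inv \<sigma> K) \<otimes> (\<sigma> K \<otimes> u)"
        using that \<sigma>_carrier by (simp add: U_def m_assoc inv_solve_left)
      also have "\<dots> \<in> ?B"
        by (rule U(5)) (use L that in \<open>auto simp: U_def K_def\<close>)
      finally show ?thesis .
    qed
    have "steady k U"
      unfolding steady_def
    proof (intro conjI exI[of _ K] allI impI ballI)
      show "openin T U"
        unfolding U_def by (rule openin_left_translation_preimage[OF U(2) \<sigma>_carrier])
      fix m n u v assume "K \<le> m" "K \<le> n" "u \<in> U" "v \<in> U"
      then have "\<sigma> m \<otimes> u \<in> ?B" "\<sigma> n \<otimes> v \<in> ?B" using in_ball by auto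
      then have "d (\<sigma> m \<otimes> u) (\<sigma> n \<otimes> v) < r + r"
        unfolding in_mball using triangle''[of "\<sigma> m \<otimes> u" y "\<sigma> n \<otimes> v"] by linarith
      also have "r + r = 1 / real (Suc k)"
        unfolding r_def by (rule field_sum_of_halves)
      finally show "d (\<sigma> m \<otimes> u) (\<sigma> n \<otimes> v) < 1 / real (Suc k)" .
    qed
    moreover have "inv \<sigma> K \<otimes> y \<in> U"
      using U(4) y \<sigma>_carrier by (simp add: U_def m_assoc[symmetric])
    moreover have "inv \<sigma> K \<otimes> y \<in> W"
      using N[of K N] x0 \<sigma>_carrier by (simp add: y_def K_def m_assoc)
    ultimately show "R k \<inter> W \<noteq> {}"
      unfolding R_def by blast
  qed
  have "T closure_of \<Inter>(range R) = topspace T"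
    using R_open R_dense by (intro Baire_category) (auto simp: compl)
  moreover have "topspace T \<noteq> {}"
    using topspace_eq_carrier one_closed by blast
  ultimately have "\<Inter>(range R) \<noteq> {}" by force
  then obtain x where x: "\<And>k. x \<in> R k" by blast
  then have x_carrier: "x \<in> carrier G"
    using R_open carrier_openin by blast
  have "MCauchy (\<lambda>n. \<sigma> n \<otimes> x)"
    unfolding MCauchy_def
  proof (intro conjI allI impI)
    show "range (\<lambda>n. \<sigma> n \<otimes> x) \<subseteq> M"
      using \<sigma>_carrier x_carrier by (auto simp: M)
    fix \<epsilon> :: real assume "\<epsilon> > 0"
    then obtain k where k: "1 / real (Suc k) < \<epsilon>" using nat_approx_posE by blast
    obtain N where "\<forall>m\<ge>N. \<forall>n\<ge>N. d (\<sigma> m \<otimes> x) (\<sigma> n \<otimes> x) < 1 / real (Suc k)"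
      using x[of k] unfolding R_def steady_def by blast
    then show "\<exists>N. \<forall>m n. N \<le> m \<longrightarrow> N \<le> n \<longrightarrow> d (\<sigma> m \<otimes> x) (\<sigma> n \<otimes> x) < \<epsilon>"
      using k by (meson less_trans)
  qed
  then obtain z where "limitin T (\<lambda>n. \<sigma> n \<otimes> x) z sequentially"
    using mcompl unfolding mcomplete_def T by blast
  then have "limitin T ((\<lambda>y. y \<otimes> inv x) \<circ> (\<lambda>n. \<sigma> n \<otimes> x)) (z \<otimes> inv x) sequentially"
    by (rule continuous_map_limit[rotated]) (simp add: continuous_right_translation x_carrier)
  then have "limitin T \<sigma> (z \<otimes> inv x) sequentially"
    using \<sigma>_carrier x_carrier by (simp add: o_def m_assoc)
  then show ?thesis by blast
qed

end

section \<open>Quotients and open epimorphisms\<close>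

text \<open>The first isomorphism theorem for topological groups.\<close>

lemma open_epimorphism_imp_is_quotient_of:
  assumes G: "topological_group G T" and H: "topological_group H S"
    and f: "f \<in> hom G H" "continuous_map T S f" "open_map T S f" "f ` carrier G = carrier H"
  shows "is_quotient_of H S G T"
proof -
  interpret G: topological_group G T by fact
  interpret H: topological_group H S by fact
  interpret group_hom G H f
    using f(1) by unfold_locales
  let ?N = "kernel G H f"
  let ?Q = "quotient_group_topology G T ?N"
  let ?h = "\<lambda>X. the_elem (f ` X)"
  have openin_Q: "openin ?Q W \<longleftrightarrow> W \<subseteq> carrier (G Mod ?N) \<and> openin T (\<Union>W)" for W
    by (rule openin_quotient_group_topology[OF G subgroup_kernel])
  have Union_cosets: "\<Union>(carrier (G Mod ?N)) = carrier G"
    using G.rcosets_part_G[OF subgroup_kernel] by (simp add: FactGroup_def)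
  have "openin ?Q (carrier (G Mod ?N))"
    using openin_Q Union_cosets G.topspace_eq_carrier by (metis openin_topspace subset_refl)
  then have topspace_Q: "topspace ?Q = carrier (G Mod ?N)"
    using openin_Q openin_subset openin_topspace by (metis subset_antisym)
  have h: "f x = ?h X" if "X \<in> carrier (G Mod ?N)" "x \<in> X" for x X
  proof -
    obtain g where g: "g \<in> carrier G" "X = ?N #>\<^bsub>G\<^esub> g"
      using \<open>X \<in> carrier _\<close> by (auto simp: FactGroup_def RCOSETS_def)
    then have fg: "f z = f g" if "z \<in> X" for z
      using that by (auto simp: kernel_def r_coset_def)
    have "f ` X = (\<lambda>_. f g) ` X"
      by (rule image_cong[OF refl]) (rule fg)
    also have "\<dots> = {f g}"
      using \<open>x \<in> X\<close> by (simp add: image_constant)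
    finally have "f ` X = {f g}" .
    then show ?thesis using fg[OF \<open>x \<in> X\<close>] by (simp only: the_elem_eq)
  qed
  have "homeomorphic_map ?Q S ?h"
  proof (rule bijective_open_imp_homeomorphic_map)
    show "continuous_map ?Q S ?h"
      unfolding continuous_map_def topspace_Q H.topspace_eq_carrier
    proof (intro conjI allI impI)
      show "?h \<in> carrier (G Mod ?N) \<rightarrow> carrier H"
        using FactGroup_the_elem_mem by blast
      fix W assume "openin S W"
      then have "openin T {x \<in> topspace T. f x \<in> W}"
        by (rule openin_continuous_map_preimage[OF f(2)])
      moreover have "\<Union>{X \<in> carrier (G Mod ?N). ?h X \<in> W} = {x \<in> topspace T. f x \<in> W}"
        unfolding G.topspace_eq_carrier Union_cosets[symmetric]
      proof (intro equalityI subsetI)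
        fix x assume "x \<in> \<Union>{X \<in> carrier (G Mod ?N). ?h X \<in> W}"
        then obtain X where "X \<in> carrier (G Mod ?N)" "?h X \<in> W" "x \<in> X" by blast
        then show "x \<in> {x \<in> \<Union>(carrier (G Mod ?N)). f x \<in> W}"
          using h[of X x] by auto
      next
        fix x assume "x \<in> {x \<in> \<Union>(carrier (G Mod ?N)). f x \<in> W}"
        then obtain X where "X \<in> carrier (G Mod ?N)" "f x \<in> W" "x \<in> X" by blast
        then show "x \<in> \<Union>{X \<in> carrier (G Mod ?N). ?h X \<in> W}"
          using h[of X x] by auto
      qed
      ultimately show "openin ?Q {X \<in> carrier (G Mod ?N). ?h X \<in> W}"
        unfolding openin_Q by auto
    qed
    show "open_map ?Q S ?h"
      unfolding open_map_def
    proof (intro allI impI)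
      fix W assume W: "openin ?Q W"
      then have W_sub: "W \<subseteq> carrier (G Mod ?N)" unfolding openin_Q by simp
      have "?h ` W = f ` \<Union>W"
      proof (intro equalityI subsetI)
        fix y assume "y \<in> ?h ` W"
        then obtain X where X: "X \<in> W" "y = ?h X" by blast
        moreover from this obtain x where "x \<in> X" using FactGroup_nonempty W_sub by blast
        ultimately have "y = f x" "x \<in> \<Union>W"
          using h[OF subsetD[OF W_sub]] by auto
        then show "y \<in> f ` \<Union>W" by (rule image_eqI)
      next
        fix y assume "y \<in> f ` \<Union>W"
        then obtain X x where "X \<in> W" "x \<in> X" "y = f x" by blast
        then have "y = ?h X" using h[OF subsetD[OF W_sub]] by simp
        then show "y \<in> ?h ` W" using \<open>X \<in> W\<close> by (rule image_eqI)
      qed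
      then show "openin S (?h ` W)"
        using W f(3) unfolding openin_Q open_map_def by auto
    qed
    show "?h ` topspace ?Q = topspace S"
      unfolding topspace_Q H.topspace_eq_carrier by (rule FactGroup_onto[OF f(4)])
    show "inj_on ?h (topspace ?Q)"
      unfolding topspace_Q by (rule FactGroup_inj_on)
  qed
  moreover have "?h \<in> iso (G Mod ?N) H"
    by (rule FactGroup_iso_set[OF f(4)])
  moreover have "closedin T ?N"
  proof -
    have "?N = {x \<in> topspace T. f x \<in> {\<one>\<^bsub>H\<^esub>}}"
      by (auto simp: kernel_def G.topspace_eq_carrier)
    moreover have "closedin S {\<one>\<^bsub>H\<^esub>}"
      by (rule closedin_Hausdorff_singleton[OF H.Hausdorff]) (simp add: H.topspace_eq_carrier)
    ultimately show ?thesis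
      by (simp only: closedin_continuous_map_preimage[OF f(2)])
  qed
  ultimately show ?thesis
    unfolding is_quotient_of_def topological_group_isomorphic_def using normal_kernel by blast
qed

text \<open>The projection to the cosets is open because the saturation of \<open>U\<close> is a union of translates of \<open>U\<close>.\<close>

lemma is_quotient_of_imp_open_epimorphism:
  assumes G: "topological_group G T" and "is_quotient_of H S G T"
  obtains f where "f \<in> hom G H" "continuous_map T S f" "open_map T S f" "f ` carrier G = carrier H"
proof -
  interpret G: topological_group G T by fact
  obtain N h where N: "N \<lhd> G" and iso: "h \<in> iso (G Mod N) H"
    and h: "homeomorphic_map (quotient_group_topology G T N) S h"
    using assms(2) unfolding is_quotient_of_def topological_group_isomorphic_def by blast
  interpret normal N G by fact
  let ?Q = "quotient_group_topology G T N"
  let ?p = "\<lambda>x. N #>\<^bsub>G\<^esub> x"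
  have openin_Q: "openin ?Q W \<longleftrightarrow> W \<subseteq> carrier (G Mod N) \<and> openin T (\<Union>W)" for W
    by (rule openin_quotient_group_topology[OF G is_subgroup])
  have p_image: "?p ` carrier G = carrier (G Mod N)"
    by (auto simp: FactGroup_def RCOSETS_def)
  have self: "x \<in> ?p x" if "x \<in> carrier G" for x
    using that is_subgroup by (rule G.rcos_self)
  have coset: "X = ?p x" if "X \<in> carrier (G Mod N)" "x \<in> X" for x X
    using that G.repr_independence[OF _ _ is_subgroup] by (auto simp: FactGroup_def RCOSETS_def)
  have "continuous_map T ?Q ?p"
    unfolding continuous_map_def G.topspace_eq_carrier
  proof (intro conjI allI impI)
    have "openin ?Q (carrier (G Mod N))"
      using openin_Q G.rcosets_part_G[OF is_subgroup] G.topspace_eq_carrier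
      by (simp add: FactGroup_def) (metis openin_topspace)
    then show "?p \<in> carrier G \<rightarrow> topspace ?Q"
      using p_image openin_subset by blast
    fix W assume "openin ?Q W"
    moreover from this have "{x \<in> carrier G. ?p x \<in> W} = \<Union>W"
    proof (intro equalityI subsetI)
      fix x assume W: "openin ?Q W" and "x \<in> \<Union>W"
      then obtain X where X: "X \<in> W" "x \<in> X" "X \<in> carrier (G Mod N)"
        unfolding openin_Q by blast
      then have "x \<in> carrier G"
        using G.rcosets_part_G[OF is_subgroup] by (auto simp: FactGroup_def)
      then show "x \<in> {x \<in> carrier G. ?p x \<in> W}"
        using coset X by simp
    qed (use self in blast)
    ultimately show "openin T {x \<in> carrier G. ?p x \<in> W}"
      unfolding openin_Q by simp
  qed
  moreover have "open_map T ?Q ?p"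
    unfolding open_map_def
  proof (intro allI impI)
    fix U assume U: "openin T U"
    then have UG: "U \<subseteq> carrier G" using G.carrier_openin by blast
    have "\<Union>(?p ` U) = (\<Union>n\<in>N. {y \<in> carrier G. inv\<^bsub>G\<^esub> n \<otimes>\<^bsub>G\<^esub> y \<in> U})"
    proof (intro equalityI subsetI)
      fix y assume "y \<in> \<Union>(?p ` U)"
      then obtain u n where "u \<in> U" "n \<in> N" "y = n \<otimes>\<^bsub>G\<^esub> u"
        by (auto simp: r_coset_def)
      then show "y \<in> (\<Union>n\<in>N. {y \<in> carrier G. inv\<^bsub>G\<^esub> n \<otimes>\<^bsub>G\<^esub> y \<in> U})"
        using UG subset by (auto simp: G.m_assoc[symmetric] subset_iff intro!: bexI[of _ n])
    next
      fix y assume "y \<in> (\<Union>n\<in>N. {y \<in> carrier G. inv\<^bsub>G\<^esub> n \<otimes>\<^bsub>G\<^esub> y \<in> U})"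
      then obtain n where n: "n \<in> N" "y \<in> carrier G" "inv\<^bsub>G\<^esub> n \<otimes>\<^bsub>G\<^esub> y \<in> U" by blast
      then have "y = n \<otimes>\<^bsub>G\<^esub> (inv\<^bsub>G\<^esub> n \<otimes>\<^bsub>G\<^esub> y)"
        using subset by (simp add: G.m_assoc[symmetric] subset_iff)
      then show "y \<in> \<Union>(?p ` U)"
        using n unfolding r_coset_def by blast
    qed
    moreover have "openin T (\<Union>n\<in>N. {y \<in> carrier G. inv\<^bsub>G\<^esub> n \<otimes>\<^bsub>G\<^esub> y \<in> U})"
      using U subset by (intro openin_Union) (auto intro!: G.openin_left_translation_preimage)
    ultimately show "openin ?Q (?p ` U)"
      unfolding openin_Q using image_mono[OF UG, of ?p] by (simp add: p_image)
  qed
  moreover have "?p \<in> hom G (G Mod N)"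
    by (rule r_coset_hom_Mod)
  moreover have "(h \<circ> ?p) ` carrier G = carrier H"
    unfolding image_comp[symmetric] p_image using iso by (simp add: iso_def bij_betw_def)
  moreover have "h \<in> hom (G Mod N) H"
    using iso by (simp add: iso_def)
  ultimately show thesis
    using homeomorphic_imp_continuous_map[OF h] homeomorphic_imp_open_map[OF h]
    by (intro that[of "h \<circ> ?p"]) (simp_all add: hom_compose continuous_map_compose open_map_compose)
qed

section \<open>Countable dense subgroups\<close>

lemma topological_group_pullback:
  assumes K: "group K" and H: "topological_group H S"
    and e: "e \<in> hom K H" "inj_on e (carrier K)"
  shows "topological_group K (pullback_topology (carrier K) e S)"
proof -
  interpret K: group K by fact
  interpret H: topological_group H S by fact
  interpret group_hom K H e using e(1) by unfold_locales
  let ?R = "pullback_topology (carrier K) e S"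
  have top: "topspace ?R = carrier K"
    by (auto simp: topspace_pullback_topology H.topspace_eq_carrier)
  have e_cont: "continuous_map ?R S e"
    using continuous_map_pullback[of S S id "carrier K" e] by simp
  show ?thesis
  proof (unfold_locales)
    show "topspace ?R = carrier K" by (rule top)
    have "continuous_map (prod_topology ?R ?R) S ((\<lambda>(x, y). x \<otimes>\<^bsub>H\<^esub> y) \<circ> (\<lambda>z. (e (fst z), e (snd z))))"
      by (intro continuous_map_compose[OF _ H.continuous_mult] continuous_map_pairedI
          continuous_map_compose[OF continuous_map_fst e_cont, unfolded o_def]
          continuous_map_compose[OF continuous_map_snd e_cont, unfolded o_def])
    then have "continuous_map (prod_topology ?R ?R) S (e \<circ> (\<lambda>(x, y). x \<otimes>\<^bsub>K\<^esub> y))"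
      by (rule continuous_map_eq) (auto simp: top)
    then show "continuous_map (prod_topology ?R ?R) ?R (\<lambda>(x, y). x \<otimes>\<^bsub>K\<^esub> y)"
      by (rule continuous_map_pullback') (auto simp: top)
    have "continuous_map ?R S (e \<circ> (\<lambda>x. inv\<^bsub>K\<^esub> x))"
      by (rule continuous_map_eq[OF continuous_map_compose[OF e_cont H.continuous_inv]]) (auto simp: top)
    then show "continuous_map ?R ?R (\<lambda>x. inv\<^bsub>K\<^esub> x)"
      by (rule continuous_map_pullback') (auto simp: top)
    show "Hausdorff_space ?R"
      by (rule Hausdorff_space_injective_preimage[OF H.Hausdorff e_cont]) (simp add: top e(2))
  qed
qed

lemma (in group) countable_generate:
  assumes "C \<subseteq> carrier G" "countable C"
  shows "countable (generate G C)"
proof -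
  let ?A = "C \<union> m_inv G ` C"
  let ?prod = "\<lambda>xs. foldr (\<otimes>) xs \<one>"
  have closed: "?prod xs \<in> carrier G" if "xs \<in> lists ?A" for xs
    using that assms(1) by (induction xs) auto
  have append: "?prod (xs @ ys) = ?prod xs \<otimes> ?prod ys" if "xs \<in> lists ?A" "ys \<in> lists ?A" for xs ys
    using that(1)
  proof (induction xs)
    case (Cons x xs)
    then show ?case using closed[of xs] closed[OF that(2)] assms(1) by (auto simp: m_assoc)
  qed (use closed[OF that(2)] in simp)
  have "x \<in> ?prod ` lists ?A" if "x \<in> generate G C" for x
    using that
  proof (induction rule: generate.induct)
    case one
    show ?case by (rule image_eqI[of _ _ "[]"]) auto
  next
    case (incl h)
    then show ?case using assms(1) by (intro image_eqI[of _ _ "[h]"]) auto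
  next
    case (inv h)
    then show ?case using assms(1) by (intro image_eqI[of _ _ "[inv h]"]) auto
  next
    case (eng h1 h2)
    then obtain xs ys where "xs \<in> lists ?A" "ys \<in> lists ?A" "h1 = ?prod xs" "h2 = ?prod ys" by blast
    then show ?case using append by (intro image_eqI[of _ _ "xs @ ys"]) auto
  qed
  moreover have "countable (?prod ` lists ?A)"
    using assms(2) by (intro countable_image countable_lists) auto
  ultimately show ?thesis
    by (meson countable_subset subsetI)
qed

text \<open>The group generated by a countable dense set, with its elements renamed to natural numbers because
  projective universality is formulated for groups of this type. The map \<open>e\<close> undoes the renaming, and pulling the
  topology of \<open>H\<close> back along \<open>e\<close> is the same as taking the subspace topology.\<close>

lemma Polish_group_dense_countable_subgroup:
  assumes "Polish_group H S"
  obtains K :: "nat monoid" and e where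
    "countable_metrizable_group K (pullback_topology (carrier K) e S)"
    "e \<in> hom K H" "inj_on e (carrier K)" "S closure_of (e ` carrier K) = topspace S"
proof -
  have H: "topological_group H S" and compl: "completely_metrizable_space S" and "separable_space S"
    using assms unfolding Polish_group_def by auto
  interpret topological_group H S by fact
  obtain C where C: "countable C" "C \<subseteq> carrier H" "S closure_of C = topspace S"
    using \<open>separable_space S\<close> unfolding separable_space_def topspace_eq_carrier by blast
  define D where "D = generate H C"
  have "countable D" unfolding D_def by (rule countable_generate[OF C(2,1)])
  interpret D: subgroup D H unfolding D_def by (rule generate_is_subgroup[OF C(2)])
  define enc where "enc = to_nat_on D"
  define e where "e = inv_into D enc"
  have enc_inj: "inj_on enc D" unfolding enc_def by (rule inj_on_to_nat_on) fact
  define K where "K = \<lparr>carrier = enc ` D, mult = \<lambda>a b. enc (e a \<otimes>\<^bsub>H\<^esub> e b), one = enc \<one>\<^bsub>H\<^esub>\<rparr>"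
  have e_enc[simp]: "e (enc x) = x" if "x \<in> D" for x
    unfolding e_def using enc_inj that by (rule inv_into_f_f)
  have carrier_K: "carrier K = enc ` D" by (simp add: K_def)
  have e_image: "e ` carrier K = D" by (force simp: carrier_K)
  have e_inj: "inj_on e (carrier K)" unfolding carrier_K by (auto simp: inj_on_def)
  have K: "group K"
  proof (rule groupI)
    show "\<exists>y\<in>carrier K. y \<otimes>\<^bsub>K\<^esub> x = \<one>\<^bsub>K\<^esub>" if x: "x \<in> carrier K" for x
    proof -
      obtain d where "d \<in> D" "x = enc d" using x unfolding carrier_K by blast
      then show ?thesis by (intro bexI[of _ "enc (inv\<^bsub>H\<^esub> d)"]) (auto simp: K_def)
    qed
  qed (auto simp: K_def m_assoc)
  have e_hom: "e \<in> hom K H"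
    by (auto simp: hom_def K_def)
  let ?R = "pullback_topology (carrier K) e S"
  have "topological_group K ?R"
    by (rule topological_group_pullback[OF K H e_hom e_inj])
  moreover have "countable (carrier K)" by simp
  moreover have "metrizable_space ?R"
  proof -
    have top: "topspace ?R = carrier K"
      using \<open>topological_group K ?R\<close> by (rule topological_group.topspace_eq_carrier)
    have DS: "D \<subseteq> topspace S" using D.subset topspace_eq_carrier by simp
    have cont: "continuous_map ?R (subtopology S D) e"
      using continuous_map_pullback[of S S id "carrier K" e] e_image top
      by (auto simp: continuous_map_in_subtopology)
    moreover have "open_map ?R (subtopology S D) e"
      unfolding open_map_def openin_pullback_topology openin_subtopology
    proof (intro allI impI)
      fix U assume "\<exists>W. openin S W \<and> U = e -` W \<inter> carrier K"
      then obtain W where "openin S W" "U = e -` W \<inter> carrier K" by blast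
      moreover from this have "e ` U = W \<inter> D" using e_image by auto
      ultimately show "\<exists>W. openin S W \<and> e ` U = W \<inter> D" by blast
    qed
    ultimately have "homeomorphic_map ?R (subtopology S D) e"
      using e_inj e_image DS top by (intro bijective_open_imp_homeomorphic_map) auto
    then show ?thesis
      using compl completely_metrizable_imp_metrizable_space metrizable_space_subtopology
        homeomorphic_metrizable_space homeomorphic_map_imp_homeomorphic_space by metis
  qed
  ultimately have "countable_metrizable_group K ?R"
    unfolding countable_metrizable_group_def by simp
  moreover have "S closure_of D = topspace S"
  proof -
    have "C \<subseteq> D" unfolding D_def by (auto intro: generate.incl)
    then show ?thesis using C(3) closure_of_mono closure_of_subset_topspace by (metis subset_antisym)
  qed
  ultimately show thesis
    using that e_hom e_inj e_image by metis
qed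

section \<open>The two-sided uniformity and the completion\<close>

lemma eventually_two_sided_uniformity:
  assumes "topological_group G T"
  shows "eventually P (two_sided_uniformity G T) \<longleftrightarrow>
    (\<exists>W. openin T W \<and> \<one>\<^bsub>G\<^esub> \<in> W \<and> (\<forall>x\<in>carrier G. \<forall>y\<in>carrier G.
       inv\<^bsub>G\<^esub> x \<otimes>\<^bsub>G\<^esub> y \<in> W \<longrightarrow> x \<otimes>\<^bsub>G\<^esub> inv\<^bsub>G\<^esub> y \<in> W \<longrightarrow> P (x, y)))" (is "?L \<longleftrightarrow> ?R")
proof
  interpret topological_group G T by fact
  have one: "\<one>\<^bsub>G\<^esub> \<in> topspace T" by (simp add: topspace_eq_carrier)
  {
    assume ?L
    then obtain A B where A: "eventually A (left_uniformity G T)" and B: "eventually B (right_uniformity G T)"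
      and AB: "\<And>z. A z \<Longrightarrow> B z \<Longrightarrow> P z"
      unfolding two_sided_uniformity_def eventually_inf by blast
    obtain U where U: "openin T U" "\<one>\<^bsub>G\<^esub> \<in> U"
      "\<forall>x\<in>carrier G. \<forall>y\<in>carrier G. inv\<^bsub>G\<^esub> x \<otimes>\<^bsub>G\<^esub> y \<in> U \<longrightarrow> A (x, y)"
      using A one unfolding left_uniformity_def eventually_inf_principal eventually_filtercomap
        eventually_nhdsin by auto
    obtain V where V: "openin T V" "\<one>\<^bsub>G\<^esub> \<in> V"
      "\<forall>x\<in>carrier G. \<forall>y\<in>carrier G. x \<otimes>\<^bsub>G\<^esub> inv\<^bsub>G\<^esub> y \<in> V \<longrightarrow> B (x, y)"
      using B one unfolding right_uniformity_def eventually_inf_principal eventually_filtercomap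
        eventually_nhdsin by auto
    show ?R
      by (rule exI[of _ "U \<inter> V"]) (use U V AB in auto)
  next
    assume ?R
    then obtain W where W: "openin T W" "\<one>\<^bsub>G\<^esub> \<in> W" "\<forall>x\<in>carrier G. \<forall>y\<in>carrier G.
       inv\<^bsub>G\<^esub> x \<otimes>\<^bsub>G\<^esub> y \<in> W \<longrightarrow> x \<otimes>\<^bsub>G\<^esub> inv\<^bsub>G\<^esub> y \<in> W \<longrightarrow> P (x, y)" by blast
    have W_ev: "eventually (\<lambda>z. z \<in> W) (nhdsin T \<one>\<^bsub>G\<^esub>)"
      using W(1,2) by (auto simp: eventually_nhdsin)
    have "eventually (\<lambda>(x, y). x \<in> carrier G \<and> y \<in> carrier G \<and> inv\<^bsub>G\<^esub> x \<otimes>\<^bsub>G\<^esub> y \<in> W) (left_uniformity G T)"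
      unfolding left_uniformity_def eventually_inf_principal
      using eventually_filtercomapI[OF W_ev, of "\<lambda>(x, y). inv\<^bsub>G\<^esub> x \<otimes>\<^bsub>G\<^esub> y"] by (auto elim!: eventually_mono)
    moreover have "eventually (\<lambda>(x, y). x \<otimes>\<^bsub>G\<^esub> inv\<^bsub>G\<^esub> y \<in> W) (right_uniformity G T)"
      unfolding right_uniformity_def eventually_inf_principal
      using eventually_filtercomapI[OF W_ev, of "\<lambda>(x, y). x \<otimes>\<^bsub>G\<^esub> inv\<^bsub>G\<^esub> y"] by (auto elim!: eventually_mono)
    ultimately show ?L
      unfolding two_sided_uniformity_def eventually_inf
      using W(3) by (intro exI conjI) auto
  }
qed

lemma countably_based_two_sided_uniformity:
  assumes G: "topological_group G T" and "first_countable T"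
  shows "countably_based (two_sided_uniformity G T)"
proof -
  interpret topological_group G T by fact
  have "\<one>\<^bsub>G\<^esub> \<in> topspace T" by (simp add: topspace_eq_carrier)
  then obtain \<B> where \<B>: "countable \<B>" "\<And>V. V \<in> \<B> \<Longrightarrow> openin T V"
    "\<And>U. openin T U \<Longrightarrow> \<one>\<^bsub>G\<^esub> \<in> U \<Longrightarrow> \<exists>V\<in>\<B>. \<one>\<^bsub>G\<^esub> \<in> V \<and> V \<subseteq> U"
    using assms(2) unfolding first_countable_def by meson
  define \<B>1 where "\<B>1 = {V \<in> \<B>. \<one>\<^bsub>G\<^esub> \<in> V}"
  have "\<exists>V\<in>\<B>. \<one>\<^bsub>G\<^esub> \<in> V \<and> V \<subseteq> topspace T"
    by (rule \<B>(3)) (auto simp: topspace_eq_carrier openin_topspace[of T, unfolded topspace_eq_carrier])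
  then have "\<B>1 \<noteq> {}" "countable \<B>1" using \<B>(1) by (auto simp: \<B>1_def)
  define B where "B = from_nat_into \<B>1"
  have B: "range B = \<B>1"
    unfolding B_def by (rule range_from_nat_into) fact+
  then have "B n \<in> \<B>1" for n by blast
  then have B_open: "openin T (B n)" "\<one>\<^bsub>G\<^esub> \<in> B n" for n
    unfolding \<B>1_def using \<B>(2) by simp_all
  have B_small: "\<exists>n. B n \<subseteq> U" if U: "openin T U" "\<one>\<^bsub>G\<^esub> \<in> U" for U
  proof -
    obtain V where "V \<in> \<B>1" "V \<subseteq> U" using \<B>(3)[OF U] unfolding \<B>1_def by blast
    then show ?thesis using B by blast
  qed
  define E where "E n = (\<lambda>(x, y). x \<in> carrier G \<and> y \<in> carrier G \<and>
      inv\<^bsub>G\<^esub> x \<otimes>\<^bsub>G\<^esub> y \<in> B n \<and> x \<otimes>\<^bsub>G\<^esub> inv\<^bsub>G\<^esub> y \<in> B n)" for n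
  have "eventually P (two_sided_uniformity G T) \<longleftrightarrow> (\<exists>n. \<forall>z. E n z \<longrightarrow> P z)" for P
    unfolding eventually_two_sided_uniformity[OF G]
  proof
    assume "\<exists>W. openin T W \<and> \<one>\<^bsub>G\<^esub> \<in> W \<and> (\<forall>x\<in>carrier G. \<forall>y\<in>carrier G.
       inv\<^bsub>G\<^esub> x \<otimes>\<^bsub>G\<^esub> y \<in> W \<longrightarrow> x \<otimes>\<^bsub>G\<^esub> inv\<^bsub>G\<^esub> y \<in> W \<longrightarrow> P (x, y))"
    then obtain W where W: "openin T W" "\<one>\<^bsub>G\<^esub> \<in> W" "\<forall>x\<in>carrier G. \<forall>y\<in>carrier G.
       inv\<^bsub>G\<^esub> x \<otimes>\<^bsub>G\<^esub> y \<in> W \<longrightarrow> x \<otimes>\<^bsub>G\<^esub> inv\<^bsub>G\<^esub> y \<in> W \<longrightarrow> P (x, y)" by blast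
    obtain n where "B n \<subseteq> W" using B_small[OF W(1,2)] by blast
    then show "\<exists>n. \<forall>z. E n z \<longrightarrow> P z"
      using W(3) by (intro exI[of _ n]) (auto simp: E_def)
  next
    assume "\<exists>n. \<forall>z. E n z \<longrightarrow> P z"
    then obtain n where "\<forall>z. E n z \<longrightarrow> P z" by blast
    then show "\<exists>W. openin T W \<and> \<one>\<^bsub>G\<^esub> \<in> W \<and> (\<forall>x\<in>carrier G. \<forall>y\<in>carrier G.
       inv\<^bsub>G\<^esub> x \<otimes>\<^bsub>G\<^esub> y \<in> W \<longrightarrow> x \<otimes>\<^bsub>G\<^esub> inv\<^bsub>G\<^esub> y \<in> W \<longrightarrow> P (x, y))"
      using B_open by (intro exI[of _ "B n"]) (auto simp: E_def)
  qed
  then show ?thesis unfolding countably_based_def by blast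
qed

text \<open>The definition of the completion, with its uniformity \<open>V\<close> as a parameter. The lemmas
  exploit only its completeness, its topology and its trace on \<open>G\<close>.\<close>

locale completed_group = G: topological_group G T + G': topological_group G' T'
  for G :: "'a monoid" and T :: "'a topology" and G' :: "'b monoid" and T' :: "'b topology" +
  fixes i :: "'a \<Rightarrow> 'b" and V :: "('b \<times> 'b) filter"
  assumes i_hom: "i \<in> hom G G'"
    and completion: "uniform_completion (carrier G) (two_sided_uniformity G T) (carrier G') V i"
    and T'_eq: "T' = uniform_topology (carrier G') V"
begin

sublocale i: group_hom G G' i
  using i_hom by unfold_locales

lemma uniform_space: "uniform_space_on (carrier G') V"
  using completion unfolding uniform_completion_def complete_uniform_space_on_def by blast

lemma dense: "T' closure_of (i ` carrier G) = topspace T'"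
  using completion unfolding uniform_completion_def T'_eq topspace_uniform_topology[OF uniform_space]
  by blast

lemma dense_meets:
  assumes "openin T' Q" "Q \<noteq> {}"
  shows "\<exists>g\<in>carrier G. i g \<in> Q"
  using dense assms unfolding dense_intersects_open by blast

text \<open>The trace of \<open>V\<close> on \<open>G\<close> is the two-sided uniformity, in terms of entourages and neighbourhoods of the
  unit. All comparisons between \<open>G\<close> and its completion rest on this.\<close>

lemma entourages_restrict:
  "(\<exists>Q. eventually Q V \<and> (\<forall>a\<in>carrier G. \<forall>b\<in>carrier G. Q (i a, i b) \<longrightarrow> P (a, b))) \<longleftrightarrow>
   (\<exists>W. openin T W \<and> \<one>\<^bsub>G\<^esub> \<in> W \<and> (\<forall>a\<in>carrier G. \<forall>b\<in>carrier G.
       inv\<^bsub>G\<^esub> a \<otimes>\<^bsub>G\<^esub> b \<in> W \<longrightarrow> a \<otimes>\<^bsub>G\<^esub> inv\<^bsub>G\<^esub> b \<in> W \<longrightarrow> P (a, b)))"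
proof -
  have "two_sided_uniformity G T =
      inf (filtercomap (map_prod i i) V) (principal (carrier G \<times> carrier G))"
    using completion unfolding uniform_completion_def by blast
  then have "eventually P (two_sided_uniformity G T) \<longleftrightarrow>
      (\<exists>Q. eventually Q V \<and> (\<forall>a\<in>carrier G. \<forall>b\<in>carrier G. Q (i a, i b) \<longrightarrow> P (a, b)))"
    by (auto simp: eventually_inf_principal eventually_filtercomap)
  then show ?thesis
    unfolding eventually_two_sided_uniformity[OF G.topological_group_axioms] by simp
qed

lemma entourage_of_neighbourhood:
  assumes "openin T W" "\<one>\<^bsub>G\<^esub> \<in> W"
  shows "\<exists>Q. eventually Q V \<and> (\<forall>a\<in>carrier G. \<forall>b\<in>carrier G. Q (i a, i b) \<longrightarrow>
           inv\<^bsub>G\<^esub> a \<otimes>\<^bsub>G\<^esub> b \<in> W \<and> a \<otimes>\<^bsub>G\<^esub> inv\<^bsub>G\<^esub> b \<in> W)"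
proof -
  let ?P = "\<lambda>(a, b). inv\<^bsub>G\<^esub> a \<otimes>\<^bsub>G\<^esub> b \<in> W \<and> a \<otimes>\<^bsub>G\<^esub> inv\<^bsub>G\<^esub> b \<in> W"
  have "\<exists>W. openin T W \<and> \<one>\<^bsub>G\<^esub> \<in> W \<and> (\<forall>a\<in>carrier G. \<forall>b\<in>carrier G.
       inv\<^bsub>G\<^esub> a \<otimes>\<^bsub>G\<^esub> b \<in> W \<longrightarrow> a \<otimes>\<^bsub>G\<^esub> inv\<^bsub>G\<^esub> b \<in> W \<longrightarrow> ?P (a, b))"
    using assms by (intro exI[of _ W]) simp
  then show ?thesis
    unfolding entourages_restrict[symmetric] by simp
qed

lemma neighbourhood_of_entourage:
  assumes "eventually Q V"
  shows "\<exists>W. openin T W \<and> \<one>\<^bsub>G\<^esub> \<in> W \<and> (\<forall>a\<in>carrier G. \<forall>b\<in>carrier G.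
       inv\<^bsub>G\<^esub> a \<otimes>\<^bsub>G\<^esub> b \<in> W \<longrightarrow> a \<otimes>\<^bsub>G\<^esub> inv\<^bsub>G\<^esub> b \<in> W \<longrightarrow> Q (i a, i b))"
proof -
  have "\<exists>R. eventually R V \<and> (\<forall>a\<in>carrier G. \<forall>b\<in>carrier G. R (i a, i b) \<longrightarrow> (\<lambda>(a, b). Q (i a, i b)) (a, b))"
    using assms by (intro exI[of _ Q]) simp
  then show ?thesis
    unfolding entourages_restrict by simp
qed

lemma continuous_embedding: "continuous_map T T' i"
  unfolding continuous_map_def
proof (intro conjI allI impI)
  show "i \<in> topspace T \<rightarrow> topspace T'"
    unfolding G.topspace_eq_carrier G'.topspace_eq_carrier by simp
  fix N assume N: "openin T' N"
  show "openin T {x \<in> topspace T. i x \<in> N}"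
  proof (subst openin_subopen, intro ballI)
    fix x assume x: "x \<in> {x \<in> topspace T. i x \<in> N}"
    then have xG: "x \<in> carrier G" by (simp add: G.topspace_eq_carrier)
    have "eventually (\<lambda>(z, y). z = i x \<longrightarrow> y \<in> N) V"
      using N x unfolding T'_eq openin_uniform_topology by blast
    from neighbourhood_of_entourage[OF this]
    obtain W where W: "openin T W" "\<one>\<^bsub>G\<^esub> \<in> W" and WN: "\<forall>a\<in>carrier G. \<forall>b\<in>carrier G.
       inv\<^bsub>G\<^esub> a \<otimes>\<^bsub>G\<^esub> b \<in> W \<longrightarrow> a \<otimes>\<^bsub>G\<^esub> inv\<^bsub>G\<^esub> b \<in> W \<longrightarrow> i a = i x \<longrightarrow> i b \<in> N"
      by auto
    let ?U = "{y \<in> carrier G. inv\<^bsub>G\<^esub> x \<otimes>\<^bsub>G\<^esub> y \<in> W} \<inter> {y \<in> carrier G. inv\<^bsub>G\<^esub> y \<in> {z \<in> carrier G. x \<otimes>\<^bsub>G\<^esub> z \<in> W}}"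
    have "openin T ?U"
      using W xG by (intro openin_Int G.openin_left_translation_preimage G.openin_inv_preimage) auto
    moreover have "x \<in> ?U" using W xG by simp
    moreover have "?U \<subseteq> {x \<in> topspace T. i x \<in> N}"
      using WN xG by (auto simp: G.topspace_eq_carrier)
    ultimately show "\<exists>U. openin T U \<and> x \<in> U \<and> U \<subseteq> {x \<in> topspace T. i x \<in> N}" by blast
  qed
qed

lemma convergent_imp_two_sided_Cauchy:
  assumes g: "range g \<subseteq> carrier G" and lim: "limitin T' (i \<circ> g) p sequentially"
  shows "two_sided_Cauchy G T g"
  unfolding two_sided_Cauchy_def
proof (intro conjI allI impI g)
  fix W assume W: "openin T W" "\<one>\<^bsub>G\<^esub> \<in> W"
  obtain Q where Q: "eventually Q V" "\<forall>a\<in>carrier G. \<forall>b\<in>carrier G. Q (i a, i b) \<longrightarrow>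
           inv\<^bsub>G\<^esub> a \<otimes>\<^bsub>G\<^esub> b \<in> W \<and> a \<otimes>\<^bsub>G\<^esub> inv\<^bsub>G\<^esub> b \<in> W"
    using entourage_of_neighbourhood[OF W] by blast
  obtain D where D: "eventually D V" "\<And>x y. D (x, y) \<Longrightarrow> D (y, x)"
    "\<And>x y z. \<lbrakk>D (x, y); D (y, z)\<rbrakk> \<Longrightarrow> Q (x, z)"
    by (rule entourage_shrink[OF uniform_space Q(1)]) blast
  have p: "p \<in> carrier G'" using limitin_topspace[OF lim] G'.topspace_eq_carrier by simp
  obtain N where N: "openin T' N" "p \<in> N" "\<And>y. y \<in> N \<Longrightarrow> D (p, y)"
    by (rule entourage_contains_neighbourhood[OF uniform_space D(1) p]) (simp add: T'_eq)
  obtain n0 where "\<And>n. n \<ge> n0 \<Longrightarrow> i (g n) \<in> N"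
    using limitinD[OF lim N(1,2)] unfolding eventually_sequentially by auto
  then have "Q (i (g m), i (g n))" if "m \<ge> n0" "n \<ge> n0" for m n
    using D(2,3) N(3) that by blast
  then show "\<exists>N. \<forall>m\<ge>N. \<forall>n\<ge>N. inv\<^bsub>G\<^esub> g m \<otimes>\<^bsub>G\<^esub> g n \<in> W \<and> g m \<otimes>\<^bsub>G\<^esub> inv\<^bsub>G\<^esub> g n \<in> W"
    using Q(2) g by blast
qed

theorem Polish_completion:
  assumes "countable (carrier G)" "first_countable T"
  shows "Polish_group G' T'"
  unfolding Polish_group_def
proof (intro conjI)
  show "topological_group G' T'" by (rule G'.topological_group_axioms)
  have "countably_based V"
    by (rule countably_based_uniform_completion[OF completion])
      (rule countably_based_two_sided_uniformity[OF G.topological_group_axioms assms(2)])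
  then show "completely_metrizable_space T'"
    using completion unfolding T'_eq uniform_completion_def
    by (intro complete_uniform_space_completely_metrizable) auto
  show "separable_space T'"
    unfolding separable_space_def
    using assms(1) dense G'.topspace_eq_carrier by (intro exI[of _ "i ` carrier G"]) auto
qed

text \<open>If \<open>i (g n)\<close> converges to \<open>p\<close>, then \<open>g\<close> is a two-sided Cauchy sequence, hence so is \<open>f \<circ> g\<close>, which
  therefore has a limit \<open>l\<close>. The value \<open>f x\<close> is close to \<open>l\<close> for every \<open>x\<close> with \<open>i x\<close> close to \<open>p\<close>, and so
  \<open>F p = l\<close> defines the extension. It is continuous because \<open>H\<close> is regular, and multiplicative because it
  is so on a dense subgroup.\<close>

theorem extend_homomorphism:
  assumes T': "metrizable_space T'"
    and H: "topological_group H S" "completely_metrizable_space S"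
    and f: "f \<in> hom G H" "continuous_map T S f"
  shows "\<exists>F. F \<in> hom G' H \<and> continuous_map T' S F \<and> (\<forall>x\<in>carrier G. F (i x) = f x)"
proof -
  interpret H: topological_group H S by fact
  interpret f: group_hom G H f using f(1) by unfold_locales
  have f_Cauchy: "two_sided_Cauchy H S (f \<circ> g)" if g: "two_sided_Cauchy G T g" for g
    unfolding two_sided_Cauchy_def
  proof (intro conjI allI impI)
    have gG: "g n \<in> carrier G" for n using g unfolding two_sided_Cauchy_def by blast
    then show "range (f \<circ> g) \<subseteq> carrier H" by auto
    fix W assume W: "openin S W" "\<one>\<^bsub>H\<^esub> \<in> W"
    have "openin T {x \<in> topspace T. f x \<in> W}" "\<one>\<^bsub>G\<^esub> \<in> {x \<in> topspace T. f x \<in> W}"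
      using openin_continuous_map_preimage[OF f(2) W(1)] W(2) by (simp_all add: G.topspace_eq_carrier)
    from two_sided_CauchyD[OF g this] obtain N where "\<forall>m\<ge>N. \<forall>n\<ge>N.
        f (inv\<^bsub>G\<^esub> g m \<otimes>\<^bsub>G\<^esub> g n) \<in> W \<and> f (g m \<otimes>\<^bsub>G\<^esub> inv\<^bsub>G\<^esub> g n) \<in> W" by blast
    then show "\<exists>N. \<forall>m\<ge>N. \<forall>n\<ge>N. inv\<^bsub>H\<^esub> (f \<circ> g) m \<otimes>\<^bsub>H\<^esub> (f \<circ> g) n \<in> W \<and>
        (f \<circ> g) m \<otimes>\<^bsub>H\<^esub> inv\<^bsub>H\<^esub> (f \<circ> g) n \<in> W"
      using gG by (intro exI[of _ N]) simp
  qed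
  have limit: "\<exists>l\<in>carrier H. \<forall>N. openin S N \<longrightarrow> l \<in> N \<longrightarrow>
      (\<exists>P. openin T' P \<and> p \<in> P \<and> (\<forall>g\<in>carrier G. i g \<in> P \<longrightarrow> f g \<in> N))"
    if p: "p \<in> carrier G'" for p
  proof -
    obtain M d where "Metric_space M d" and T'_metric: "T' = Metric_space.mtopology M d"
      using T' unfolding metrizable_space_def by blast
    then interpret M: Metric_space M d by simp
    have "p \<in> T' closure_of (i ` carrier G)"
      using p dense G'.topspace_eq_carrier by simp
    then obtain \<sigma> where \<sigma>: "range \<sigma> \<subseteq> i ` carrier G" "limitin T' \<sigma> p sequentially"
      unfolding T'_metric M.closure_of_sequentially by blast
    have "\<exists>x. x \<in> carrier G \<and> i x = \<sigma> n" for n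
      using subsetD[OF \<sigma>(1) rangeI, of n] by (auto simp: image_iff)
    then obtain g where g: "\<And>n. g n \<in> carrier G \<and> i (g n) = \<sigma> n"
      by metis
    then have gG: "range g \<subseteq> carrier G" and "i \<circ> g = \<sigma>"
      by (auto simp: fun_eq_iff)
    then have lim: "limitin T' (i \<circ> g) p sequentially" using \<sigma>(2) by simp
    obtain l where l: "limitin S (f \<circ> g) l sequentially"
      using H.two_sided_Cauchy_imp_convergent[OF H(2) f_Cauchy[OF convergent_imp_two_sided_Cauchy[OF gG lim]]]
      by blast
    have lH: "l \<in> carrier H" using limitin_topspace[OF l] H.topspace_eq_carrier by simp
    show ?thesis
    proof (intro bexI[OF _ lH] allI impI)
      fix N assume N: "openin S N" "l \<in> N"
      then have N': "\<one>\<^bsub>H\<^esub> \<otimes>\<^bsub>H\<^esub> l \<in> N" using lH by simp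
      obtain U1 U2 where U: "openin S U1" "openin S U2" "\<one>\<^bsub>H\<^esub> \<in> U1" "l \<in> U2"
        "\<And>u v. \<lbrakk>u \<in> U1; v \<in> U2\<rbrakk> \<Longrightarrow> u \<otimes>\<^bsub>H\<^esub> v \<in> N"
        by (rule H.mult_neighbourhoods[OF N(1) H.one_closed lH N']) (rule that)
      have W: "openin T {x \<in> topspace T. f x \<in> U1}" "\<one>\<^bsub>G\<^esub> \<in> {x \<in> topspace T. f x \<in> U1}"
        using openin_continuous_map_preimage[OF f(2) U(1)] U(3) by (simp_all add: G.topspace_eq_carrier)
      obtain Q where Q: "eventually Q V" "\<forall>a\<in>carrier G. \<forall>b\<in>carrier G. Q (i a, i b) \<longrightarrow> f (a \<otimes>\<^bsub>G\<^esub> inv\<^bsub>G\<^esub> b) \<in> U1"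
        using entourage_of_neighbourhood[OF W] by blast
      obtain D where D: "eventually D V" "\<And>x y. D (x, y) \<Longrightarrow> D (y, x)"
        "\<And>x y z. \<lbrakk>D (x, y); D (y, z)\<rbrakk> \<Longrightarrow> Q (x, z)"
        by (rule entourage_shrink[OF uniform_space Q(1)]) blast
      obtain P where P: "openin T' P" "p \<in> P" "\<And>y. y \<in> P \<Longrightarrow> D (p, y)"
        by (rule entourage_contains_neighbourhood[OF uniform_space D(1) p]) (simp add: T'_eq)
      have "eventually (\<lambda>n. (i \<circ> g) n \<in> P \<and> (f \<circ> g) n \<in> U2) sequentially"
        by (rule eventually_conj[OF limitinD[OF lim P(1,2)] limitinD[OF l U(2,4)]])
      then obtain n where n: "i (g n) \<in> P" "f (g n) \<in> U2"
        unfolding eventually_sequentially by auto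
      have "f x \<in> N" if x: "x \<in> carrier G" "i x \<in> P" for x
      proof -
        have "Q (i x, i (g n))" using D(2,3) P(3) x(2) n(1) by blast
        then have "f (x \<otimes>\<^bsub>G\<^esub> inv\<^bsub>G\<^esub> g n) \<in> U1" using Q(2) x(1) g by blast
        then have "f (x \<otimes>\<^bsub>G\<^esub> inv\<^bsub>G\<^esub> g n) \<otimes>\<^bsub>H\<^esub> f (g n) \<in> N" using n(2) U(5) by blast
        also have "f (x \<otimes>\<^bsub>G\<^esub> inv\<^bsub>G\<^esub> g n) \<otimes>\<^bsub>H\<^esub> f (g n) = f x"
          using x(1) g[of n] by (simp add: H.m_assoc)
        finally show ?thesis .
      qed
      then show "\<exists>P. openin T' P \<and> p \<in> P \<and> (\<forall>g\<in>carrier G. i g \<in> P \<longrightarrow> f g \<in> N)"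
        using P(1,2) by blast
    qed
  qed
  then obtain F where F: "\<And>p. p \<in> carrier G' \<Longrightarrow> F p \<in> carrier H"
    and F_lim: "\<And>p N. \<lbrakk>p \<in> carrier G'; openin S N; F p \<in> N\<rbrakk> \<Longrightarrow>
       \<exists>P. openin T' P \<and> p \<in> P \<and> (\<forall>g\<in>carrier G. i g \<in> P \<longrightarrow> f g \<in> N)"
    by metis
  have regular: "neighbourhood_base_of (closedin S) S"
    unfolding neighbourhood_base_of_closedin
    by (intro metrizable_imp_regular_space completely_metrizable_imp_metrizable_space H(2))
  have F_cont: "continuous_map T' S F"
    unfolding continuous_map_def
  proof (intro conjI allI impI)
    show "F \<in> topspace T' \<rightarrow> topspace S"
      unfolding G'.topspace_eq_carrier H.topspace_eq_carrier using F by blast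
    fix N assume N: "openin S N"
    show "openin T' {p \<in> topspace T'. F p \<in> N}"
    proof (subst openin_subopen, intro ballI)
      fix p assume p: "p \<in> {p \<in> topspace T'. F p \<in> N}"
      then have pG': "p \<in> carrier G'" by (simp add: G'.topspace_eq_carrier)
      obtain N' C where N': "openin S N'" "closedin S C" "F p \<in> N'" "N' \<subseteq> C" "C \<subseteq> N"
        using regular[unfolded neighbourhood_base_of, rule_format, of N "F p"] N p by auto
      obtain P where P: "openin T' P" "p \<in> P" "\<forall>g\<in>carrier G. i g \<in> P \<longrightarrow> f g \<in> N'"
        using F_lim[OF pG' N'(1,3)] by blast
      \<comment> \<open>If \<open>F q\<close> were outside \<open>C\<close>, then points of \<open>G\<close> close to \<open>q\<close> would have values outside \<open>C\<close>, but
        those in \<open>P\<close> have values in \<open>N' \<subseteq> C\<close>.\<close>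
      have "F q \<in> C" if q: "q \<in> P" for q
      proof (rule ccontr)
        assume "F q \<notin> C"
        moreover have qG': "q \<in> carrier G'" using q P(1) G'.carrier_openin by blast
        ultimately have "F q \<in> topspace S - C" using F H.topspace_eq_carrier by simp
        moreover have "openin S (topspace S - C)" using N'(2) by blast
        ultimately obtain P2 where P2: "openin T' P2" "q \<in> P2" "\<forall>g\<in>carrier G. i g \<in> P2 \<longrightarrow> f g \<in> topspace S - C"
          using F_lim[OF qG'] by blast
        have "openin T' (P \<inter> P2)" "P \<inter> P2 \<noteq> {}" using P(1) P2(1,2) q by blast+
        then obtain g where "g \<in> carrier G" "i g \<in> P \<inter> P2"
          using dense_meets by blast
        then show False using P(3) P2(3) N'(4) by blast
      qed
      then have "P \<subseteq> {p \<in> topspace T'. F p \<in> N}"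
        using N'(5) openin_subset[OF P(1)] by blast
      then show "\<exists>U. openin T' U \<and> p \<in> U \<and> U \<subseteq> {p \<in> topspace T'. F p \<in> N}"
        using P(1,2) by blast
    qed
  qed
  have F_i: "F (i x) = f x" if x: "x \<in> carrier G" for x
  proof (rule ccontr)
    assume "F (i x) \<noteq> f x"
    moreover have "F (i x) \<in> topspace S" "f x \<in> topspace S"
      using x F by (simp_all add: H.topspace_eq_carrier)
    ultimately obtain A B where AB: "openin S A" "openin S B" "F (i x) \<in> A" "f x \<in> B" "disjnt A B"
      using H.Hausdorff unfolding Hausdorff_space_def by blast
    obtain P where "i x \<in> P" "\<forall>g\<in>carrier G. i g \<in> P \<longrightarrow> f g \<in> A"
      using F_lim[OF i.hom_closed[OF x] AB(1,3)] by blast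
    then show False using x AB by (auto simp: disjnt_iff)
  qed
  have "F (p \<otimes>\<^bsub>G'\<^esub> q) = F p \<otimes>\<^bsub>H\<^esub> F q" if "p \<in> carrier G'" "q \<in> carrier G'" for p q
  proof -
    let ?X = "prod_topology T' T'"
    let ?l = "F \<circ> (\<lambda>(x, y). x \<otimes>\<^bsub>G'\<^esub> y)"
    let ?r = "(\<lambda>(x, y). x \<otimes>\<^bsub>H\<^esub> y) \<circ> (\<lambda>z. (F (fst z), F (snd z)))"
    have "?l (p, q) = ?r (p, q)"
    proof (rule forall_in_closure_of_eq[where f = ?l and g = ?r])
      show "(p, q) \<in> ?X closure_of (i ` carrier G \<times> i ` carrier G)"
        unfolding closure_of_Times dense using that by (simp add: G'.topspace_eq_carrier)
      show "Hausdorff_space S" by (rule H.Hausdorff)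
      show "continuous_map ?X S ?l"
        by (rule continuous_map_compose[OF G'.continuous_mult F_cont])
      show "continuous_map ?X S ?r"
        by (intro continuous_map_compose[OF _ H.continuous_mult] continuous_map_pairedI
          continuous_map_compose[OF continuous_map_fst F_cont, unfolded o_def]
          continuous_map_compose[OF continuous_map_snd F_cont, unfolded o_def])
      fix z assume "z \<in> i ` carrier G \<times> i ` carrier G"
      then obtain x y where xy: "x \<in> carrier G" "y \<in> carrier G" "z = (i x, i y)" by blast
      have "F (i x \<otimes>\<^bsub>G'\<^esub> i y) = F (i (x \<otimes>\<^bsub>G\<^esub> y))" using xy by simp
      also have "\<dots> = f x \<otimes>\<^bsub>H\<^esub> f y" using xy F_i[of "x \<otimes>\<^bsub>G\<^esub> y"] by simp
      finally show "?l z = ?r z"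
        using xy F_i by simp
    qed
    then show ?thesis by simp
  qed
  then have "F \<in> hom G' H" using F by (simp add: hom_def)
  then show ?thesis using F_cont F_i by blast
qed

end

section \<open>Open surjections by Baire category\<close>

text \<open>For open \<open>U\<close> in \<open>X\<close> let \<open>w U\<close> be an open set of \<open>Y\<close> with trace \<open>F ` (U \<inter> S)\<close> on the dense set \<open>F ` S\<close>. The
  sets \<open>w B\<close>, for small balls \<open>B\<close> centred in the countable set \<open>S\<close> whose closed balls lie in \<open>U\<close>, cover
  \<open>w U \<inter> F ` S\<close>, so their union is dense in \<open>w U\<close>. Hence a generic point \<open>h\<close> of \<open>w U\<close> belongs to some \<open>w B\<close>,
  and genericity is needed only for \<open>U = U0\<close> and the countably many balls. Iterating this gives a
  shrinking nested sequence of balls, and \<open>F\<close> maps their common point to \<open>h\<close>.\<close>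

lemma residual_image:
  assumes X: "completely_metrizable_space X" and F: "continuous_map X Y F"
    and Y: "Hausdorff_space Y"
    and S: "countable S" "S \<subseteq> topspace X" and dense: "Y closure_of (F ` S) = topspace Y"
    and relatively_open: "\<And>U. openin X U \<Longrightarrow> \<exists>W. openin Y W \<and> W \<inter> F ` S = F ` (U \<inter> S)"
    and U0: "openin X U0" and W0: "openin Y W0" "W0 \<inter> F ` S = F ` (U0 \<inter> S)"
  shows "\<exists>\<G>. countable \<G> \<and> (\<forall>D\<in>\<G>. openin Y D \<and> Y closure_of D = topspace Y) \<and>
           W0 \<inter> \<Inter>\<G> \<subseteq> F ` U0"
proof -
  obtain M d where "Metric_space M d" and mcompl: "Metric_space.mcomplete M d"
    and X_eq: "X = Metric_space.mtopology M d"
    using X unfolding completely_metrizable_space_def by blast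
  then interpret Metric_space M d by simp
  have dense_meets: "F ` S \<inter> Q \<noteq> {}" if "openin Y Q" "Q \<noteq> {}" for Q
    using dense that unfolding dense_intersects_open by blast
  have S_M: "S \<subseteq> M" using S(2) X_eq by simp
  \<comment> \<open>At \<open>U0\<close> the choice is prescribed, since the conclusion is about the given \<open>W0\<close>.\<close>
  define w where "w U = (if U = U0 then W0 else SOME W. openin Y W \<and> W \<inter> F ` S = F ` (U \<inter> S))" for U
  have w: "openin Y (w U) \<and> w U \<inter> F ` S = F ` (U \<inter> S)" if "openin X U" for U
  proof (cases "U = U0")
    case False
    then show ?thesis
      unfolding w_def using someI_ex[OF relatively_open[OF that]] by simp
  qed (use W0 in \<open>simp add: w_def\<close>)
  have w_open: "openin Y (w U)" and w_image: "w U \<inter> F ` S = F ` (U \<inter> S)" if "openin X U" for U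
    using w[OF that] by auto
  define ball where "ball p = (case p of (s, k) \<Rightarrow> mball s (1 / real (Suc k)))" for p
  define cball where "cball p = (case p of (s, k) \<Rightarrow> mcball s (1 / real (Suc k)))" for p
  have ball_open: "openin X (ball p)" for p
    by (simp add: ball_def X_eq split: prod.split)
  define subballs where "subballs U n = {p. p \<in> S \<times> {n..} \<and> cball p \<subseteq> U}" for U n
  \<comment> \<open>The complement of the closure of \<open>w U\<close> is added because \<open>D U n\<close> is to be dense in all of \<open>Y\<close>.\<close>
  define D where "D U n = (\<Union>p\<in>subballs U n. w (ball p)) \<union> (topspace Y - Y closure_of (w U))" for U n
  define \<C> where "\<C> = insert U0 (ball ` (S \<times> UNIV))"
  have \<C>_open: "openin X U" if "U \<in> \<C>" for U
    using that U0 ball_open by (auto simp: \<C>_def)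
  have subballs_exist: "\<exists>p\<in>subballs U n. s \<in> ball p" if U: "openin X U" and s: "s \<in> U" "s \<in> S" for U s n
  proof -
    obtain r where r: "r > 0" "mball s r \<subseteq> U"
      using U s unfolding X_eq openin_mtopology by blast
    obtain k where k: "1 / real (Suc k) < r" using nat_approx_posE[OF r(1)] by blast
    have "1 / real (Suc (max k n)) \<le> 1 / real (Suc k)"
      by (simp add: frac_le)
    then have "mcball s (1 / real (Suc (max k n))) \<subseteq> mball s r"
      using k by (intro mcball_subset_mball_concentric) linarith
    then have "(s, max k n) \<in> subballs U n"
      using r s unfolding subballs_def cball_def by auto
    moreover have "s \<in> ball (s, max k n)"
      using s S_M unfolding ball_def by auto
    ultimately show ?thesis by blast
  qed
  have D_open: "openin Y (D U n)" for U n
    unfolding D_def using w_open[OF ball_open] closedin_closure_of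
    by (intro openin_Un openin_Union openin_diff) auto
  have D_dense: "Y closure_of (D U n) = topspace Y" if U: "openin X U" for U n
    unfolding dense_intersects_open
  proof (intro allI impI)
    fix Q assume Q: "openin Y Q \<and> Q \<noteq> {}"
    show "D U n \<inter> Q \<noteq> {}"
    proof (cases "Q \<inter> w U = {}")
      case True
      then have "Q \<inter> Y closure_of (w U) = {}"
        using Q openin_Int_closure_of_eq_empty by blast
      then show ?thesis using Q openin_subset unfolding D_def by fastforce
    next
      case False
      have "openin Y (Q \<inter> w U)" using Q w_open[OF U] by blast
      then have "F ` S \<inter> (Q \<inter> w U) \<noteq> {}"
        using dense_meets False by blast
      then obtain y where y: "y \<in> Q" "y \<in> F ` (U \<inter> S)" using w_image[OF U] by blast
      then obtain s where s: "s \<in> U" "s \<in> S" "y = F s" by blast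
      obtain p where p: "p \<in> subballs U n" "s \<in> ball p" using subballs_exist[OF U s(1,2)] by blast
      then have "y \<in> w (ball p)" using s w_image[OF ball_open, of p] by blast
      then show ?thesis using p y unfolding D_def by blast
    qed
  qed
  let ?\<G> = "(\<lambda>(U, n). D U n) ` (\<C> \<times> UNIV)"
  have "countable ?\<G>"
    using S(1) unfolding \<C>_def by (intro countable_image countable_SIGMA countable_insert) auto
  moreover have "\<forall>D\<in>?\<G>. openin Y D \<and> Y closure_of D = topspace Y"
    using D_open D_dense \<C>_open by auto
  moreover have "W0 \<inter> \<Inter>?\<G> \<subseteq> F ` U0"
  proof
    fix h assume h: "h \<in> W0 \<inter> \<Inter>?\<G>"
    have h_top: "h \<in> topspace Y" using h openin_subset[OF W0(1)] by blast
    have descend: "\<exists>p\<in>subballs U n. h \<in> w (ball p)" if "U \<in> \<C>" "h \<in> w U" for U n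
    proof -
      have "h \<in> D U n" using h that(1) by auto
      moreover have "w U \<subseteq> Y closure_of (w U)"
        using w_open[OF \<C>_open[OF that(1)]] by (intro closure_of_subset openin_subset)
      ultimately show ?thesis using that(2) unfolding D_def by blast
    qed
    \<comment> \<open>The ball number \<open>Suc n\<close> has radius at most \<open>1 / Suc n\<close> and its closed ball lies in the previous ball.\<close>
    have "\<exists>p. \<forall>n. (p n \<in> subballs U0 0 \<and> h \<in> w (ball (p n))) \<and> p (Suc n) \<in> subballs (ball (p n)) n"
    proof (rule dependent_nat_choice)
      have "h \<in> w U0" using h by (simp add: w_def)
      then show "\<exists>p. p \<in> subballs U0 0 \<and> h \<in> w (ball p)"
        using descend[of U0 0] by (auto simp: \<C>_def)
      fix p n assume p: "p \<in> subballs U0 0 \<and> h \<in> w (ball p)"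
      then have "ball p \<in> \<C>" by (auto simp: \<C>_def subballs_def)
      then obtain q where q: "q \<in> subballs (ball p) n" "h \<in> w (ball q)" using descend p by blast
      have "ball p \<subseteq> cball p" by (auto simp: ball_def cball_def split: prod.split)
      then have "q \<in> subballs U0 0" using p q(1) by (auto simp: subballs_def)
      then show "\<exists>q. (q \<in> subballs U0 0 \<and> h \<in> w (ball q)) \<and> q \<in> subballs (ball p) n" using q by blast
    qed
    then obtain p where p: "\<And>n. p n \<in> subballs U0 0" "\<And>n. h \<in> w (ball (p n))"
      "\<And>n. p (Suc n) \<in> subballs (ball (p n)) n" by blast
    define C where "C n = cball (p n)" for n
    have p_S: "fst (p n) \<in> S" for n using p(1)[of n] by (auto simp: subballs_def)
    have small: "\<exists>n. 1 / real (Suc (snd (p n))) < e" if "e > 0" for e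
    proof -
      obtain k where k: "1 / real (Suc k) < e" using nat_approx_posE[OF \<open>e > 0\<close>] by blast
      have "k \<le> snd (p (Suc k))" using p(3)[of k] by (auto simp: subballs_def)
      then have "1 / real (Suc (snd (p (Suc k)))) \<le> 1 / real (Suc k)" by (simp add: frac_le)
      then show ?thesis using k by (intro exI[of _ "Suc k"]) linarith
    qed
    have "\<exists>l. l \<in> M \<and> \<Inter>(range C) = {l}"
    proof (rule mcompl[unfolded mcomplete_nest_sing, rule_format], intro conjI allI impI)
      show "closedin mtopology (C n)" for n
        by (simp add: C_def cball_def split: prod.split)
      have "fst (p n) \<in> C n" for n
        using p_S[of n] S_M by (auto simp: C_def cball_def split: prod.split)
      then show "C n \<noteq> {}" for n by blast
      show "decseq C"
      proof (rule decseq_SucI)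
        have "ball (p n) \<subseteq> cball (p n)" for n
          by (auto simp: ball_def cball_def split: prod.split)
        then show "C (Suc n) \<subseteq> C n" for n
          using p(3)[of n] unfolding C_def subballs_def by blast
      qed
      fix e :: real assume "e > 0"
      then obtain n where "1 / real (Suc (snd (p n))) < e" using small by blast
      then have "C n \<subseteq> mcball (fst (p n)) e"
        unfolding C_def cball_def by (auto split: prod.split)
      then show "\<exists>n a. C n \<subseteq> mcball a e" by blast
    qed
    then obtain l where l: "l \<in> M" "\<And>n. l \<in> C n" by blast
    have "l \<in> U0"
      using l(2)[of 0] p(1)[of 0] by (auto simp: C_def subballs_def)
    moreover have "F l = h"
    proof (rule ccontr)
      assume neq: "F l \<noteq> h"
      have "F l \<in> topspace Y" using F l(1) X_eq by (auto simp: continuous_map_def)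
      then obtain Q1 Q2 where Q: "openin Y Q1" "openin Y Q2" "F l \<in> Q1" "h \<in> Q2" "disjnt Q1 Q2"
        using Y h_top neq unfolding Hausdorff_space_def by blast
      have "openin X {x \<in> topspace X. F x \<in> Q1}"
        by (rule openin_continuous_map_preimage[OF F Q(1)])
      then obtain e where e: "e > 0" "mball l e \<subseteq> {x \<in> topspace X. F x \<in> Q1}"
        using l(1) Q(3) unfolding X_eq openin_mtopology by auto
      obtain n where n: "1 / real (Suc (snd (p n))) < e / 2" using small[of "e / 2"] e(1) by auto
      have "openin Y (Q2 \<inter> w (ball (p n)))" "Q2 \<inter> w (ball (p n)) \<noteq> {}"
        using Q(4) p(2)[of n] openin_Int[OF Q(2) w_open[OF ball_open]] by blast+
      then have "F ` S \<inter> (Q2 \<inter> w (ball (p n))) \<noteq> {}"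
        by (rule dense_meets)
      then obtain y where "y \<in> w (ball (p n)) \<inter> F ` S" and y: "y \<in> Q2" by blast
      from this(1) obtain s where "s \<in> ball (p n)" "y = F s"
        unfolding w_image[OF ball_open] by blast
      then have s: "s \<in> ball (p n)" "F s \<in> Q2" using y by auto
      have "l \<in> mcball (fst (p n)) (1 / real (Suc (snd (p n))))"
        using l(2)[of n] by (simp add: C_def cball_def case_prod_unfold)
      moreover have "s \<in> mball (fst (p n)) (1 / real (Suc (snd (p n))))"
        using s(1) by (simp only: ball_def case_prod_unfold)
      ultimately have "d l s < e" "s \<in> M"
        using n triangle''[of l "fst (p n)" s] by (simp_all only: in_mball in_mcball) linarith
      then have "F s \<in> Q1" using e(2) l(1) by auto
      then show False using Q(5) s(2) by (auto simp: disjnt_iff)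
    qed
    ultimately show "h \<in> F ` U0" by blast
  qed
  ultimately show ?thesis by blast
qed

lemma (in topological_group) dense_left_translation:
  assumes "openin T D" "T closure_of D = topspace T" "h \<in> carrier G"
  shows "T closure_of {y \<in> carrier G. h \<otimes> y \<in> D} = topspace T"
  unfolding dense_intersects_open
proof (intro allI impI)
  fix Q assume Q: "openin T Q \<and> Q \<noteq> {}"
  have "openin T {z \<in> carrier G. inv h \<otimes> z \<in> Q}"
    using Q assms(3) by (simp add: openin_left_translation_preimage)
  moreover obtain q where q: "q \<in> Q" "q \<in> carrier G" using Q carrier_openin by blast
  then have "h \<otimes> q \<in> {z \<in> carrier G. inv h \<otimes> z \<in> Q}"
    using assms(3) by (simp add: m_assoc[symmetric])
  ultimately have "D \<inter> {z \<in> carrier G. inv h \<otimes> z \<in> Q} \<noteq> {}"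
    using assms(2) unfolding dense_intersects_open by blast
  then obtain z where z: "z \<in> D" "z \<in> carrier G" "inv h \<otimes> z \<in> Q" by blast
  then have "inv h \<otimes> z \<in> {y \<in> carrier G. h \<otimes> y \<in> D}"
    using assms(3) by (simp add: m_assoc[symmetric])
  then show "{y \<in> carrier G. h \<otimes> y \<in> D} \<inter> Q \<noteq> {}" using z by blast
qed

text \<open>Let \<open>U\<close> be a neighbourhood of the unit of \<open>P\<close> with \<open>u \<otimes> inv v \<in> N\<close> for \<open>u, v \<in> U\<close>, and \<open>W\<close> an open set
  whose trace on \<open>F ` A\<close> is the image of \<open>U \<inter> A\<close>. For \<open>h \<in> W\<close> the open
  sets \<open>W\<close> and \<open>h W\<close> meet, namely in \<open>h\<close>, and in their intersection \<open>F ` U\<close> and its translate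
  by \<open>h\<close> are both residual. They have a common point
  \<open>F u = h \<otimes> F v\<close>, so that \<open>h \<in> F ` N\<close>. Thus \<open>F\<close> is open at the unit, and by translation everywhere; its
  image is then an open subgroup that is dense, which is all of \<open>H\<close>.\<close>

theorem open_surjective_homomorphism:
  assumes P: "topological_group P T" "completely_metrizable_space T"
    and H: "topological_group H S" "completely_metrizable_space S"
    and F: "F \<in> hom P H" "continuous_map T S F"
    and A: "countable A" "A \<subseteq> carrier P" "\<one>\<^bsub>P\<^esub> \<in> A"
    and dense: "S closure_of (F ` A) = topspace S"
    and relatively_open: "\<And>U. openin T U \<Longrightarrow> \<exists>W. openin S W \<and> W \<inter> F ` A = F ` (U \<inter> A)"
  shows "open_map T S F" and "F ` carrier P = carrier H"
proof -
  interpret P: topological_group P T by fact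
  interpret H: topological_group H S by fact
  interpret group_hom P H F using F(1) by unfold_locales
  have neighbourhood: "\<exists>W. openin S W \<and> \<one>\<^bsub>H\<^esub> \<in> W \<and> W \<subseteq> F ` N"
    if N: "openin T N" "\<one>\<^bsub>P\<^esub> \<in> N" for N
  proof -
    obtain U where U: "openin T U" "\<one>\<^bsub>P\<^esub> \<in> U" "\<And>u v. \<lbrakk>u \<in> U; v \<in> U\<rbrakk> \<Longrightarrow> u \<otimes>\<^bsub>P\<^esub> inv\<^bsub>P\<^esub> v \<in> N"
      by (rule P.division_neighbourhood[OF N]) (rule that)
    obtain W where W: "openin S W" "W \<inter> F ` A = F ` (U \<inter> A)"
      using relatively_open[OF U(1)] by blast
    have "F \<one>\<^bsub>P\<^esub> \<in> F ` (U \<inter> A)" using U(2) A(3) by blast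
    then have one_W: "\<one>\<^bsub>H\<^esub> \<in> W" using W(2) by auto
    have "A \<subseteq> topspace T" using A(2) P.topspace_eq_carrier by simp
    from residual_image[OF P(2) F(2) H.Hausdorff A(1) this dense relatively_open U(1) W]
    obtain \<G> where \<G>: "countable \<G>" "\<And>D. D \<in> \<G> \<Longrightarrow> openin S D" "\<And>D. D \<in> \<G> \<Longrightarrow> S closure_of D = topspace S"
      and residual: "W \<inter> \<Inter>\<G> \<subseteq> F ` U" by blast
    have "h \<in> F ` N" if h: "h \<in> W" for h
    proof -
      have hH: "h \<in> carrier H" using h W(1) H.carrier_openin by blast
      define shift where "shift D = {y \<in> carrier H. inv\<^bsub>H\<^esub> h \<otimes>\<^bsub>H\<^esub> y \<in> D}" for D
      have shift_open: "openin S (shift D)" if "openin S D" for D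
        unfolding shift_def using that hH by (simp add: H.openin_left_translation_preimage)
      \<comment> \<open>\<open>shift D\<close> is the translate \<open>h D\<close>; membership in all \<open>D\<close> and all \<open>shift D\<close> puts \<open>x\<close> into both residual sets.\<close>
      have "S closure_of \<Inter>(\<G> \<union> shift ` \<G>) = topspace S"
      proof (rule Baire_category)
        show "countable (\<G> \<union> shift ` \<G>)" using \<G>(1) by simp
        fix D assume "D \<in> \<G> \<union> shift ` \<G>"
        then show "openin S D \<and> S closure_of D = topspace S"
          using \<G>(2,3) shift_open H.dense_left_translation[OF _ _ H.inv_closed[OF hH]]
          by (auto simp: shift_def)
      qed (use H(2) in simp)
      moreover have "openin S (W \<inter> shift W)" using W(1) shift_open by blast
      moreover have "h \<in> W \<inter> shift W" using h hH one_W by (simp add: shift_def)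
      ultimately have "\<Inter>(\<G> \<union> shift ` \<G>) \<inter> (W \<inter> shift W) \<noteq> {}"
        unfolding dense_intersects_open by blast
      then obtain x where x: "x \<in> \<Inter>(\<G> \<union> shift ` \<G>)" "x \<in> W" "x \<in> shift W" by blast
      have xH: "x \<in> carrier H" using x(3) by (simp add: shift_def)
      have "x \<in> F ` U" using x residual by blast
      moreover have "inv\<^bsub>H\<^esub> h \<otimes>\<^bsub>H\<^esub> x \<in> W \<inter> \<Inter>\<G>"
      proof -
        have "x \<in> shift D" if "D \<in> \<G>" for D using x(1) that by blast
        then show ?thesis using x(3) by (simp add: shift_def)
      qed
      then have "inv\<^bsub>H\<^esub> h \<otimes>\<^bsub>H\<^esub> x \<in> F ` U" using residual by blast
      ultimately obtain u v where uv: "u \<in> U" "v \<in> U" "x = F u" "inv\<^bsub>H\<^esub> h \<otimes>\<^bsub>H\<^esub> x = F v" by blast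
      have carr: "u \<in> carrier P" "v \<in> carrier P" using uv U(1) P.carrier_openin by blast+
      have "F (u \<otimes>\<^bsub>P\<^esub> inv\<^bsub>P\<^esub> v) = x \<otimes>\<^bsub>H\<^esub> inv\<^bsub>H\<^esub> (inv\<^bsub>H\<^esub> h \<otimes>\<^bsub>H\<^esub> x)"
        using carr uv(3,4) by simp
      also have "\<dots> = h"
        using xH hH by (simp add: H.inv_mult_group H.m_assoc[symmetric])
      finally show ?thesis using U(3)[OF uv(1,2)] by blast
    qed
    then show ?thesis using W(1) one_W by blast
  qed
  show "open_map T S F"
    unfolding open_map_def
  proof (intro allI impI)
    fix N assume N: "openin T N"
    show "openin S (F ` N)"
    proof (subst openin_subopen, intro ballI)
      fix y assume "y \<in> F ` N"
      then obtain p where p: "p \<in> N" "y = F p" "p \<in> carrier P" using N P.carrier_openin by blast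
      have "openin T {z \<in> carrier P. p \<otimes>\<^bsub>P\<^esub> z \<in> N}" "\<one>\<^bsub>P\<^esub> \<in> {z \<in> carrier P. p \<otimes>\<^bsub>P\<^esub> z \<in> N}"
        using N p by (simp_all add: P.openin_left_translation_preimage)
      from neighbourhood[OF this] obtain W where W: "openin S W" "\<one>\<^bsub>H\<^esub> \<in> W"
        "W \<subseteq> F ` {z \<in> carrier P. p \<otimes>\<^bsub>P\<^esub> z \<in> N}" by blast
      have "{x \<in> carrier H. inv\<^bsub>H\<^esub> y \<otimes>\<^bsub>H\<^esub> x \<in> W} \<subseteq> F ` N"
      proof
        fix x assume "x \<in> {x \<in> carrier H. inv\<^bsub>H\<^esub> y \<otimes>\<^bsub>H\<^esub> x \<in> W}"
        then obtain z where z: "x \<in> carrier H" "z \<in> carrier P" "p \<otimes>\<^bsub>P\<^esub> z \<in> N" "inv\<^bsub>H\<^esub> y \<otimes>\<^bsub>H\<^esub> x = F z"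
          using W(3) by blast
        have "F (p \<otimes>\<^bsub>P\<^esub> z) = y \<otimes>\<^bsub>H\<^esub> (inv\<^bsub>H\<^esub> y \<otimes>\<^bsub>H\<^esub> x)" using z p by simp
        also have "\<dots> = x" using z(1) p by (simp add: H.m_assoc[symmetric])
        finally show "x \<in> F ` N" using z(3) by blast
      qed
      moreover have "openin S {x \<in> carrier H. inv\<^bsub>H\<^esub> y \<otimes>\<^bsub>H\<^esub> x \<in> W}"
        using W(1) p by (simp add: H.openin_left_translation_preimage)
      moreover have "y \<in> {x \<in> carrier H. inv\<^bsub>H\<^esub> y \<otimes>\<^bsub>H\<^esub> x \<in> W}"
        using W(2) p by simp
      ultimately show "\<exists>V. openin S V \<and> y \<in> V \<and> V \<subseteq> F ` N" by blast
    qed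
  qed
  show "F ` carrier P = carrier H"
  proof (intro equalityI subsetI)
    fix h assume h: "h \<in> carrier H"
    have "openin T (carrier P)" using openin_topspace[of T] P.topspace_eq_carrier by simp
    from neighbourhood[OF this P.one_closed] obtain W where
      W: "openin S W" "\<one>\<^bsub>H\<^esub> \<in> W" "W \<subseteq> F ` carrier P" by blast
    let ?V = "{y \<in> carrier H. inv\<^bsub>H\<^esub> y \<in> {z \<in> carrier H. z \<otimes>\<^bsub>H\<^esub> h \<in> W}}"
    have "openin S ?V"
      using W(1) h by (intro H.openin_inv_preimage H.openin_right_translation_preimage)
    moreover have "h \<in> ?V" using W(2) h by simp
    ultimately have "F ` A \<inter> ?V \<noteq> {}"
      using dense unfolding dense_intersects_open by blast
    then obtain a where a: "a \<in> A" "inv\<^bsub>H\<^esub> F a \<otimes>\<^bsub>H\<^esub> h \<in> W" by blast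
    then obtain p where p: "p \<in> carrier P" "inv\<^bsub>H\<^esub> F a \<otimes>\<^bsub>H\<^esub> h = F p" using W(3) by blast
    have aP: "a \<in> carrier P" using a A(2) by blast
    have "F (a \<otimes>\<^bsub>P\<^esub> p) = F a \<otimes>\<^bsub>H\<^esub> (inv\<^bsub>H\<^esub> F a \<otimes>\<^bsub>H\<^esub> h)" using p aP by simp
    also have "\<dots> = h" using aP h by (simp add: H.m_assoc[symmetric])
    finally have "h = F (a \<otimes>\<^bsub>P\<^esub> p)" by simp
    then show "h \<in> F ` carrier P" using aP p(1) by blast
  qed auto
qed

section \<open>Couniversality of the completion\<close>

theorem theorem2p1:
  fixes G :: "'a monoid" and T :: "'a topology"
    and Ghat :: "'b monoid" and That :: "'b topology" and i :: "'a \<Rightarrow> 'b"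
  assumes "projectively_universal_countable_metrizable_group G T"
    and "Rajkov_completion G T Ghat That i"
  shows "projectively_universal_Polish_group TYPE('h) Ghat That"
proof -
  have G: "topological_group G T" "countable (carrier G)" "metrizable_space T"
    and universal: "\<And>(K :: nat monoid) R. countable_metrizable_group K R \<Longrightarrow> is_quotient_of K R G T"
    using assms(1) unfolding projectively_universal_countable_metrizable_group_def
      countable_metrizable_group_def by auto
  obtain V where "topological_group Ghat That" "i \<in> hom G Ghat"
    "uniform_completion (carrier G) (two_sided_uniformity G T) (carrier Ghat) V i"
    "That = uniform_topology (carrier Ghat) V"
    using assms(2) unfolding Rajkov_completion_def by blast
  then interpret completed_group G T Ghat That i V
    using G(1) by (simp add: completed_group_def completed_group_axioms_def)
  have Polish: "Polish_group Ghat That"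
    using G(2,3) by (intro Polish_completion metrizable_imp_first_countable)
  have "is_quotient_of H S Ghat That" if H: "Polish_group H S" for H :: "'h monoid" and S
  proof -
    have HS: "topological_group H S" "completely_metrizable_space S"
      using H unfolding Polish_group_def by auto
    have GS: "topological_group Ghat That" "completely_metrizable_space That"
      using Polish unfolding Polish_group_def by auto
    obtain K :: "nat monoid" and e where
      K: "countable_metrizable_group K (pullback_topology (carrier K) e S)" and
      e: "e \<in> hom K H" "inj_on e (carrier K)" "S closure_of (e ` carrier K) = topspace S"
      by (rule Polish_group_dense_countable_subgroup[OF H]) (rule that)
    let ?R = "pullback_topology (carrier K) e S"
    have R: "topspace ?R = carrier K"
      using K unfolding countable_metrizable_group_def by (simp add: topological_group.topspace_eq_carrier)
    obtain q where q: "q \<in> hom G K" "continuous_map T ?R q" "open_map T ?R q" "q ` carrier G = carrier K"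
      by (rule is_quotient_of_imp_open_epimorphism[OF G(1) universal[OF K]]) (rule that)
    have e_cont: "continuous_map ?R S e"
      using continuous_map_pullback[of S S id "carrier K" e] by simp
    have "e \<circ> q \<in> hom G H" by (rule hom_compose[OF q(1) e(1)])
    moreover have "continuous_map T S (e \<circ> q)" by (rule continuous_map_compose[OF q(2) e_cont])
    moreover have "metrizable_space That"
      using GS(2) by (rule completely_metrizable_imp_metrizable_space)
    ultimately obtain F where F: "F \<in> hom Ghat H" "continuous_map That S F"
      "\<And>x. x \<in> carrier G \<Longrightarrow> F (i x) = e (q x)"
      using extend_homomorphism[OF _ HS] by fastforce
    have F_image: "F ` i ` U = e ` q ` U" if "U \<subseteq> carrier G" for U
      unfolding image_image using F(3) that by (intro image_cong) auto
    have F_dense: "S closure_of (F ` i ` carrier G) = topspace S"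
      using F_image[OF subset_refl] q(4) e(3) by simp
    have relatively_open: "\<exists>W. openin S W \<and> W \<inter> F ` i ` carrier G = F ` (N \<inter> i ` carrier G)"
      if N: "openin That N" for N
    proof -
      let ?U = "{x \<in> topspace T. i x \<in> N}"
      have "openin T ?U" by (rule openin_continuous_map_preimage[OF continuous_embedding N])
      then have "openin ?R (q ` ?U)" using q(3) unfolding open_map_def by blast
      then obtain W where W: "openin S W" "q ` ?U = e -` W \<inter> carrier K"
        unfolding openin_pullback_topology by blast
      have "N \<inter> i ` carrier G = i ` ?U" by (auto simp: G.topspace_eq_carrier)
      then have "F ` (N \<inter> i ` carrier G) = e ` q ` ?U"
        using F_image[of ?U] by (simp add: G.topspace_eq_carrier)
      also have "\<dots> = W \<inter> e ` carrier K" unfolding W(2) by blast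
      also have "e ` carrier K = F ` i ` carrier G"
        using F_image[OF subset_refl] q(4) by simp
      finally show ?thesis using W(1) by blast
    qed
    have one: "\<one>\<^bsub>Ghat\<^esub> \<in> i ` carrier G"
      by (rule image_eqI[of _ _ "\<one>\<^bsub>G\<^esub>"]) simp_all
    have sub: "i ` carrier G \<subseteq> carrier Ghat" by auto
    note open_surjective =
      open_surjective_homomorphism[OF GS HS F(1,2) countable_image[OF G(2)] sub one F_dense relatively_open]
    show ?thesis
      by (rule open_epimorphism_imp_is_quotient_of[OF GS(1) HS(1) F(1,2) open_surjective])
  qed
  then show ?thesis
    unfolding projectively_universal_Polish_group_def using Polish by blast
qed

end
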